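(* Let $c\in\{0,N\}$. A zero-mean Gaussian sequence $[x_k]=(x_0,\dots,x_N)$ of $\mathbb{R}^d$-valued random vectors is $CM_c$ if and only if there exist $d\times d$ matrices $G_{k,k-1}, G_{k,c}$ ($k\in[1,N]\setminus\{c\}$), a matrix $G_{0,N}$ in case $c=N$, and a zero-mean white Gaussian sequence $[e_k]=(e_0,\dots,e_N)$ with covariances $G_k=\mathrm{Cov}(e_k)$, such that (almost surely) $$x_k=G_{k,k-1}x_{k-1}+G_{k,c}x_c+e_k,\qquad k\in[1,N]\setminus\{c\},\qquad (1)$$ with the boundary condition $$x_c=e_c,\qquad x_0=G_{0,c}x_c+e_0\ \ (\text{the second equation only for } c=N).\qquad (2)$$ Equivalently, $[x_k]$ is $CM_c$ if and only if it obeys (1), for some such matrices and some zero-mean white Gaussian sequence $[e_k]$ with $G_k=\mathrm{Cov}(e_k)$, with the boundary condition $$x_0=e_0,\qquad x_c=G_{c,0}x_0+e_c\ \ (\text{the second equation only for } c=N),\qquad (3)$$ for some matrix $G_{N,0}$ in case $c=N$ (the vectors $e_0,e_N$ in (2) and in (3) need not be the same).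
   Context: Sequences are indexed by discrete time $[0,N]=(0,1,\dots,N)$; $[i,j]=(i,i+1,\dots,j)$, $[x_k]_i^j=(x_i,\dots,x_j)$ and $[x_k]=[x_k]_0^N$. A Gaussian sequence is a sequence of jointly Gaussian $\mathbb{R}^d$-valued vectors; its covariance may be singular or nonsingular. A white Gaussian sequence is a jointly Gaussian sequence with $e_k,e_j$ uncorrelated for $k\ne j$; the covariances $\mathrm{Cov}(e_k)$ may be singular. For $c\in\{0,N\}$, $[x_k]$ is $CM_c$ iff conditioned on the state $x_c$ the sequence is Markov over $[1,N]$ (if $c=0$) or over $[0,N-1]$ (if $c=N$); equivalently, with $F(\cdot|\cdot)$ denoting conditional CDF, $F(\xi_k|[x_i]_0^j,x_c)=F(\xi_k|x_j,x_c)$ (a.s.) for all $j,k\in[0,N]$ with $j<k$ and all $\xi_k\in\mathbb{R}^d$. *)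

theory Defs
  imports "HOL-Probability.Probability"
begin

definition gaussian_rv :: "'a measure \<Rightarrow> ('a \<Rightarrow> real) \<Rightarrow> bool" where
  "gaussian_rv M Y \<longleftrightarrow> Y \<in> borel_measurable M \<and>
     ((\<exists>\<mu> \<sigma>. 0 < \<sigma> \<and> distributed M lborel Y (normal_density \<mu> \<sigma>)) \<or>
      (\<exists>\<mu>. AE \<omega> in M. Y \<omega> = \<mu>))"

text \<open>Joint Gaussianity of \<open>x 0, \<dots>, x N\<close>: every linear combination of all components is
  univariate Gaussian. The point masses admitted by \<^const>\<open>gaussian_rv\<close> allow singular covariances.
  Only the values of \<open>x\<close> at indices up to \<open>N\<close> matter.\<close>
definition gaussian_seq :: "'a measure \<Rightarrow> nat \<Rightarrow> (nat \<Rightarrow> 'a \<Rightarrow> real ^ 'd) \<Rightarrow> bool" where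
  "gaussian_seq M N x \<longleftrightarrow>
     (\<forall>k\<le>N. x k \<in> borel_measurable M) \<and>
     (\<forall>a :: nat \<Rightarrow> real ^ 'd. gaussian_rv M (\<lambda>\<omega>. \<Sum>k\<le>N. a k \<bullet> x k \<omega>))"

definition zero_mean_seq :: "'a measure \<Rightarrow> nat \<Rightarrow> (nat \<Rightarrow> 'a \<Rightarrow> real ^ 'd) \<Rightarrow> bool" where
  "zero_mean_seq M N x \<longleftrightarrow> (\<forall>k\<le>N. integral\<^sup>L M (x k) = 0)"

definition cross_cov :: "'a measure \<Rightarrow> ('a \<Rightarrow> real ^ 'd) \<Rightarrow> ('a \<Rightarrow> real ^ 'd) \<Rightarrow> real ^ 'd ^ 'd" where
  "cross_cov M X Y = (\<chi> i j. LINT \<omega>|M. (X \<omega> - integral\<^sup>L M X) $ i * (Y \<omega> - integral\<^sup>L M Y) $ j)"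

abbreviation Cov :: "'a measure \<Rightarrow> ('a \<Rightarrow> real ^ 'd) \<Rightarrow> real ^ 'd ^ 'd" where
  "Cov M X \<equiv> cross_cov M X X"

definition white_gaussian_seq :: "'a measure \<Rightarrow> nat \<Rightarrow> (nat \<Rightarrow> 'a \<Rightarrow> real ^ 'd) \<Rightarrow> bool" where
  "white_gaussian_seq M N e \<longleftrightarrow>
     gaussian_seq M N e \<and> (\<forall>k\<le>N. \<forall>j\<le>N. k \<noteq> j \<longrightarrow> cross_cov M (e k) (e j) = 0)"

definition generated_by :: "'a measure \<Rightarrow> (nat \<Rightarrow> 'a \<Rightarrow> real ^ 'd) \<Rightarrow> nat set \<Rightarrow> 'a measure" where
  "generated_by M x I =
     sigma (space M) (\<Union>i\<in>I. {x i -` A \<inter> space M | A. A \<in> sets borel})"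

text \<open>The order on \<^typ>\<open>real ^ 'd\<close> is componentwise, so this is the usual multivariate CDF,
  conditioned on the \<open>\<sigma>\<close>-algebra \<open>F\<close>.\<close>
definition cond_cdf :: "'a measure \<Rightarrow> 'a measure \<Rightarrow> ('a \<Rightarrow> real ^ 'd) \<Rightarrow> real ^ 'd \<Rightarrow> 'a \<Rightarrow> real" where
  "cond_cdf M F Y \<xi> = real_cond_exp M F (indicator {\<omega> \<in> space M. Y \<omega> \<le> \<xi>})"

definition CM_seq :: "'a measure \<Rightarrow> nat \<Rightarrow> nat \<Rightarrow> (nat \<Rightarrow> 'a \<Rightarrow> real ^ 'd) \<Rightarrow> bool" where
  "CM_seq M N c x \<longleftrightarrow>
     (\<forall>j k. j < k \<longrightarrow> k \<le> N \<longrightarrow> (\<forall>\<xi>. AE \<omega> in M.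
        cond_cdf M (generated_by M x ({0..j} \<union> {c})) (x k) \<xi> \<omega> =
        cond_cdf M (generated_by M x {j, c}) (x k) \<xi> \<omega>))"

text \<open>The matrices are doubly indexed. The index pairs of \<open>G k (k - 1)\<close> and \<open>G k c\<close> coincide only
  for \<open>c = 0\<close>, \<open>k = 1\<close>, where both terms act on \<open>x 0\<close>; asking for two separate matrices
  there would be the same, as only their sum matters.\<close>
definition CM_dynamics ::
  "'a measure \<Rightarrow> nat \<Rightarrow> nat \<Rightarrow> (nat \<Rightarrow> 'a \<Rightarrow> real ^ 'd) \<Rightarrow> (nat \<Rightarrow> nat \<Rightarrow> real ^ 'd ^ 'd) \<Rightarrow>
    (nat \<Rightarrow> 'a \<Rightarrow> real ^ 'd) \<Rightarrow> bool" where
  "CM_dynamics M N c x G e \<longleftrightarrow>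
     (\<forall>k\<in>{1..N} - {c}. AE \<omega> in M.
        x k \<omega> = G k (k - 1) *v x (k - 1) \<omega> + G k c *v x c \<omega> + e k \<omega>)"

definition boundary_from_c ::
  "'a measure \<Rightarrow> nat \<Rightarrow> nat \<Rightarrow> (nat \<Rightarrow> 'a \<Rightarrow> real ^ 'd) \<Rightarrow> (nat \<Rightarrow> nat \<Rightarrow> real ^ 'd ^ 'd) \<Rightarrow>
    (nat \<Rightarrow> 'a \<Rightarrow> real ^ 'd) \<Rightarrow> bool" where
  "boundary_from_c M N c x G e \<longleftrightarrow>
     (AE \<omega> in M. x c \<omega> = e c \<omega>) \<and>
     (c = N \<longrightarrow> (AE \<omega> in M. x 0 \<omega> = G 0 c *v x c \<omega> + e 0 \<omega>))"

definition boundary_from_0 ::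
  "'a measure \<Rightarrow> nat \<Rightarrow> nat \<Rightarrow> (nat \<Rightarrow> 'a \<Rightarrow> real ^ 'd) \<Rightarrow> (nat \<Rightarrow> nat \<Rightarrow> real ^ 'd ^ 'd) \<Rightarrow>
    (nat \<Rightarrow> 'a \<Rightarrow> real ^ 'd) \<Rightarrow> bool" where
  "boundary_from_0 M N c x G e \<longleftrightarrow>
     (AE \<omega> in M. x 0 \<omega> = e 0 \<omega>) \<and>
     (c = N \<longrightarrow> (AE \<omega> in M. x c \<omega> = G c 0 *v x 0 \<omega> + e c \<omega>))"

end

theory Submission
  imports Defs
begin

text \<open>
  Both dynamic models say the same thing: there are matrices for which every residual
  \<open>x\<^sub>k - G\<^sub>k\<^sub>,\<^sub>k\<^sub>-\<^sub>1 x\<^sub>k\<^sub>-\<^sub>1 - G\<^sub>k\<^sub>,\<^sub>c x\<^sub>c\<close> is uncorrelated with \<open>x\<^sub>c\<close> and with the whole past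
  \<open>x\<^sub>0, \<dots>, x\<^sub>k\<^sub>-\<^sub>1\<close>; the boundary conditions only decide which of \<open>x\<^sub>0\<close>, \<open>x\<^sub>c\<close> is projected on the other.
  Given such matrices, iterating the recursion from \<open>j\<close> to \<open>k\<close> writes \<open>x\<^sub>k\<close> as a linear function of
  \<open>(x\<^sub>j, x\<^sub>c)\<close> plus a noise term uncorrelated with, hence independent of, \<open>(x\<^sub>0, \<dots>, x\<^sub>j, x\<^sub>c)\<close>, so the
  conditional distribution function depends on \<open>(x\<^sub>j, x\<^sub>c)\<close> only. Conversely, let \<open>Z\<close> be the residual
  of some \<open>x\<^sub>i\<close>, \<open>i < k\<close>, after projection on \<open>(x\<^sub>k\<^sub>-\<^sub>1, x\<^sub>c)\<close>. The \<open>CM\<^sub>c\<close> property and the independence of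
  \<open>Z\<close> from \<open>(x\<^sub>k\<^sub>-\<^sub>1, x\<^sub>c)\<close> give \<open>E[Z 1{x\<^sub>k \<le> \<xi>}] = 0\<close> for all \<open>\<xi>\<close>, hence \<open>E[Z x\<^sub>k\<^sup>T] = 0\<close>: projecting \<open>x\<^sub>k\<close> on
  \<open>(x\<^sub>k\<^sub>-\<^sub>1, x\<^sub>c)\<close> already yields a residual uncorrelated with the whole past. No covariance is
  inverted, so singular ones need no separate treatment.
\<close>

subsection \<open>Signed measures with vanishing characteristic function\<close>

context prob_space
begin

lemma integrable_mult_cis:
  fixes f :: "'a \<Rightarrow> complex"
  assumes f: "integrable M f" and V: "V \<in> borel_measurable M"
  shows "integrable M (\<lambda>\<omega>. f \<omega> * cis (V \<omega>))"
  by (rule Bochner_Integration.integrable_bound[OF f]) (use assms in \<open>auto simp: norm_mult cis_conv_exp\<close>)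

lemma integrable_mult_indicator_vimage:
  fixes f :: "'a \<Rightarrow> 'b::{real_normed_algebra_1, second_countable_topology, banach}"
  assumes f: "integrable M f" and V: "V \<in> measurable M N" and B: "B \<in> sets N"
  shows "integrable M (\<lambda>\<omega>. f \<omega> * indicator B (V \<omega>))"
  by (rule Bochner_Integration.integrable_bound[OF f]) (use assms in \<open>auto simp: indicator_def\<close>)

text \<open>Levy uniqueness concerns probability measures, so the signed density \<open>f\<close> is
  split into its positive and negative parts. Normalised and pushed forward by \<open>V\<close>,
  these have equal characteristic functions and hence coincide.\<close>

lemma real_integral_indicator_zero_of_char_zero:
  fixes f V :: "'a \<Rightarrow> real"
  assumes f: "integrable M f" and V: "V \<in> borel_measurable M"
    and zero: "\<And>t. (LINT \<omega>|M. complex_of_real (f \<omega>) * cis (t * V \<omega>)) = 0"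
    and B: "B \<in> sets borel"
  shows "(LINT \<omega>|M. f \<omega> * indicator B (V \<omega>)) = 0"
proof -
  note [measurable] = V B borel_measurable_integrable[OF f]
  define p n where "p = (\<lambda>\<omega>. max (f \<omega>) 0)" and "n = (\<lambda>\<omega>. max (- f \<omega>) 0)"
  have fpn: "f \<omega> = p \<omega> - n \<omega>" for \<omega> by (simp add: p_def n_def)
  have int: "integrable M p" "integrable M n"
    using f by (auto simp: p_def n_def)
  note [measurable] = borel_measurable_integrable[OF int(1)] borel_measurable_integrable[OF int(2)]
  have nonneg: "0 \<le> p \<omega>" "0 \<le> n \<omega>" for \<omega> by (auto simp: p_def n_def)
  define m where "m = integral\<^sup>L M p"
  have eqc: "(LINT \<omega>|M. complex_of_real (p \<omega>) * cis (t * V \<omega>)) =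
      (LINT \<omega>|M. complex_of_real (n \<omega>) * cis (t * V \<omega>))" for t
  proof -
    have i: "integrable M (\<lambda>\<omega>. complex_of_real (p \<omega>) * cis (t * V \<omega>))"
      "integrable M (\<lambda>\<omega>. complex_of_real (n \<omega>) * cis (t * V \<omega>))"
      by (intro integrable_mult_cis; use int in simp)+
    have "(LINT \<omega>|M. complex_of_real (p \<omega>) * cis (t * V \<omega>)) -
        (LINT \<omega>|M. complex_of_real (n \<omega>) * cis (t * V \<omega>)) =
        (LINT \<omega>|M. complex_of_real (f \<omega>) * cis (t * V \<omega>))"
      by (subst Bochner_Integration.integral_diff[OF i, symmetric]) (simp add: fpn algebra_simps)
    then show ?thesis using zero[of t] by simp
  qed
  \<comment> \<open>Frequency 0 compares the total masses, so one constant normalises both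
    parts.\<close>
  have m': "integral\<^sup>L M n = m"
    using eqc[of 0] by (simp add: m_def int)
  have main: "(LINT \<omega>|M. p \<omega> * indicator B (V \<omega>)) = (LINT \<omega>|M. n \<omega> * indicator B (V \<omega>))"
  \<comment> \<open>Zero mass cannot be normalised, but then both parts vanish almost
    everywhere.\<close>
  proof (cases "m = 0")
    case True
    have "AE \<omega> in M. p \<omega> = 0" "AE \<omega> in M. n \<omega> = 0"
      using integral_nonneg_eq_0_iff_AE[OF int(1)] integral_nonneg_eq_0_iff_AE[OF int(2)]
        True m' nonneg by (auto simp: m_def)
    then show ?thesis by (intro integral_cong_AE) auto
  next
    case False
    have mpos: "m > 0"
      using False Bochner_Integration.integral_nonneg[of M p] nonneg by (simp add: m_def order.not_eq_order_implies_strict)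
    define \<nu> where "\<nu> q = distr (density M (\<lambda>\<omega>. ennreal (q \<omega> / m))) borel V" for q
    have int_\<nu>: "integral\<^sup>L (\<nu> q) g = (LINT \<omega>|M. (q \<omega> / m) *\<^sub>R g (V \<omega>))"
      if [measurable]: "q \<in> borel_measurable M" "g \<in> borel_measurable borel"
        and q: "\<And>\<omega>. 0 \<le> q \<omega>" for q and g :: "real \<Rightarrow> 'c::{banach, second_countable_topology}"
      unfolding \<nu>_def using q mpos
      by (subst integral_distr, simp, simp, subst integral_density) auto
    have rd: "real_distribution (\<nu> q)" if q: "integrable M q" "\<And>\<omega>. 0 \<le> q \<omega>" "integral\<^sup>L M q = m" for q
    proof -
      have [measurable]: "q \<in> borel_measurable M" using q by auto
      have "emeasure (\<nu> q) (space (\<nu> q)) = (\<integral>\<^sup>+\<omega>. ennreal (q \<omega> / m) \<partial>M)"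
        unfolding \<nu>_def by (simp add: emeasure_distr emeasure_density cong: nn_integral_cong_simp)
      also have "\<dots> = ennreal (LINT \<omega>|M. q \<omega> / m)"
        using q mpos by (intro nn_integral_eq_integral) auto
      also have "\<dots> = 1" using q mpos by simp
      finally show ?thesis
        by (auto simp: real_distribution_def real_distribution_axioms_def \<nu>_def intro!: prob_spaceI)
    qed
    have ch: "char (\<nu> q) t = (LINT \<omega>|M. complex_of_real (q \<omega>) * cis (t * V \<omega>)) / m"
      if q: "integrable M q" "\<And>\<omega>. 0 \<le> q \<omega>" for q t
    proof -
      have [measurable]: "q \<in> borel_measurable M" using q by auto
      have "char (\<nu> q) t = (LINT \<omega>|M. (q \<omega> / m) *\<^sub>R iexp (t * V \<omega>))"
        unfolding char_def by (rule int_\<nu>) (use q in auto)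
      also have "\<dots> = (LINT \<omega>|M. complex_of_real (q \<omega>) * cis (t * V \<omega>) / m)"
        by (rule Bochner_Integration.integral_cong) (auto simp: scaleR_conv_of_real cis_conv_exp)
      finally show ?thesis by simp
    qed
    have "\<nu> p = \<nu> n"
      by (rule Levy_uniqueness) (use int nonneg m' in \<open>auto intro!: rd simp: m_def ch eqc fun_eq_iff\<close>)
    then have "(LINT \<omega>|M. (p \<omega> / m) *\<^sub>R (indicator B (V \<omega>) :: real)) =
        (LINT \<omega>|M. (n \<omega> / m) *\<^sub>R (indicator B (V \<omega>) :: real))"
      using int_\<nu>[of p "indicator B :: real \<Rightarrow> real"] int_\<nu>[of n "indicator B :: real \<Rightarrow> real"] nonneg by auto
    then show ?thesis using mpos by simp
  qed
  have i: "integrable M (\<lambda>\<omega>. p \<omega> * indicator B (V \<omega>))" "integrable M (\<lambda>\<omega>. n \<omega> * indicator B (V \<omega>))"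
    by (intro integrable_mult_indicator_vimage[OF _ V B] int)+
  have "(LINT \<omega>|M. f \<omega> * indicator B (V \<omega>)) =
      (LINT \<omega>|M. p \<omega> * indicator B (V \<omega>)) - (LINT \<omega>|M. n \<omega> * indicator B (V \<omega>))"
    by (subst Bochner_Integration.integral_diff[OF i, symmetric]) (simp add: fpn algebra_simps)
  then show ?thesis using main by simp
qed

text \<open>Conjugation turns frequency \<open>t\<close> into \<open>- t\<close>, so the hypothesis
  passes from \<open>f\<close> to \<open>cnj f\<close>, and thus to the real and imaginary parts.
  Complex densities are wanted because the induction over coordinates multiplies densities by
  \<open>cis\<close>.\<close>

lemma integral_indicator_zero_of_char_zero:
  fixes f :: "'a \<Rightarrow> complex" and V :: "'a \<Rightarrow> real"
  assumes f: "integrable M f" and V: "V \<in> borel_measurable M"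
    and zero: "\<And>t. (LINT \<omega>|M. f \<omega> * cis (t * V \<omega>)) = 0"
    and B: "B \<in> sets borel"
  shows "(LINT \<omega>|M. f \<omega> * indicator B (V \<omega>)) = 0"
proof -
  have cnj0: "(LINT \<omega>|M. cnj (f \<omega>) * cis (t * V \<omega>)) = 0" for t
  proof -
    have "(LINT \<omega>|M. cnj (f \<omega>) * cis (t * V \<omega>)) = cnj (LINT \<omega>|M. f \<omega> * cis ((- t) * V \<omega>))"
      by (subst integral_bounded_linear[OF bounded_linear_cnj integrable_mult_cis[OF f], symmetric])
        (use V in \<open>auto simp: cis_cnj\<close>)
    then show ?thesis by (simp only: zero) simp
  qed
  have if': "integrable M (\<lambda>\<omega>. cnj (f \<omega>))" using f by simp
  have re: "(LINT \<omega>|M. complex_of_real (Re (f \<omega>)) * cis (t * V \<omega>)) = 0" for t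
  proof -
    have "(LINT \<omega>|M. complex_of_real (Re (f \<omega>)) * cis (t * V \<omega>)) =
        (LINT \<omega>|M. (f \<omega> * cis (t * V \<omega>) + cnj (f \<omega>) * cis (t * V \<omega>)) / 2)"
      by (rule Bochner_Integration.integral_cong)
        (auto simp: complex_eq_iff algebra_simps)
    also have "\<dots> = 0"
      using integrable_mult_cis[OF f, of "\<lambda>\<omega>. t * V \<omega>"] integrable_mult_cis[OF if', of "\<lambda>\<omega>. t * V \<omega>"] V
      by (simp add: zero cnj0)
    finally show ?thesis .
  qed
  have im: "(LINT \<omega>|M. complex_of_real (Im (f \<omega>)) * cis (t * V \<omega>)) = 0" for t
  proof -
    have "(LINT \<omega>|M. complex_of_real (Im (f \<omega>)) * cis (t * V \<omega>)) =
        (LINT \<omega>|M. (f \<omega> * cis (t * V \<omega>) - cnj (f \<omega>) * cis (t * V \<omega>)) / (2 * \<i>))"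
      by (rule Bochner_Integration.integral_cong)
        (auto simp: complex_eq_iff algebra_simps Re_divide Im_divide power2_eq_square)
    also have "\<dots> = 0"
      using integrable_mult_cis[OF f, of "\<lambda>\<omega>. t * V \<omega>"] integrable_mult_cis[OF if', of "\<lambda>\<omega>. t * V \<omega>"] V
      by (simp add: zero cnj0)
    finally show ?thesis .
  qed
  have fB: "integrable M (\<lambda>\<omega>. f \<omega> * indicator B (V \<omega>))"
    by (rule integrable_mult_indicator_vimage[OF f V B])
  have ReIm: "Re (z * indicator B v) = Re z * indicator B v" "Im (z * indicator B v) = Im z * indicator B v"
    for z :: complex and v by (auto simp: indicator_def)
  have "Re (LINT \<omega>|M. f \<omega> * indicator B (V \<omega>)) = 0"
    using real_integral_indicator_zero_of_char_zero[OF integrable_Re[OF f] V re B]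
    by (subst integral_Re[OF fB, symmetric]) (simp only: ReIm)
  moreover have "Im (LINT \<omega>|M. f \<omega> * indicator B (V \<omega>)) = 0"
    using real_integral_indicator_zero_of_char_zero[OF integrable_Im[OF f] V im B]
    by (subst integral_Im[OF fB, symmetric]) (simp only: ReIm)
  ultimately show ?thesis by (simp add: complex_eq_iff)
qed

text \<open>Coordinates are removed one at a time, absorbing the indicators already obtained into the complex
  density \<open>f\<close>; this reduces the multivariate uniqueness theorem to the univariate one.\<close>

lemma integral_rectangle_zero_of_char_zero:
  fixes f :: "'a \<Rightarrow> complex" and V :: "'i \<Rightarrow> 'a \<Rightarrow> real"
  assumes "finite I" and f: "integrable M f" and V: "\<And>i. i \<in> I \<Longrightarrow> V i \<in> borel_measurable M"
    and zero: "\<And>t. (LINT \<omega>|M. f \<omega> * cis (\<Sum>i\<in>I. t i * V i \<omega>)) = 0"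
    and B: "\<And>i. i \<in> I \<Longrightarrow> B i \<in> sets borel"
  shows "(LINT \<omega>|M. f \<omega> * (\<Prod>i\<in>I. indicator (B i) (V i \<omega>))) = 0"
  using assms
proof (induction I arbitrary: f rule: finite_induct)
  case empty
  then show ?case by simp
next
  case (insert j I)
  have [measurable]: "V j \<in> borel_measurable M" "\<And>i. i \<in> I \<Longrightarrow> V i \<in> borel_measurable M"
    using insert.prems by auto
  have Bj: "B j \<in> sets borel" using insert.prems by auto
  have "(LINT \<omega>|M. (f \<omega> * indicator (B j) (V j \<omega>)) * (\<Prod>i\<in>I. indicator (B i) (V i \<omega>))) = 0"
  proof (rule insert.IH)
    show "integrable M (\<lambda>\<omega>. f \<omega> * indicator (B j) (V j \<omega>))"
      by (rule integrable_mult_indicator_vimage[OF insert.prems(1) _ Bj]) simp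
    fix t :: "'i \<Rightarrow> real"
    \<comment> \<open>The frequencies of the other coordinates are moved into the density, which
      leaves a transform in \<open>V j\<close> alone.\<close>
    have "(LINT \<omega>|M. (f \<omega> * cis (\<Sum>i\<in>I. t i * V i \<omega>)) * indicator (B j) (V j \<omega>)) = 0"
    proof (rule integral_indicator_zero_of_char_zero[OF _ _ _ Bj])
      show "integrable M (\<lambda>\<omega>. f \<omega> * cis (\<Sum>i\<in>I. t i * V i \<omega>))"
        by (rule integrable_mult_cis[OF insert.prems(1)]) simp
      fix s
      have "(\<Sum>i\<in>insert j I. (t(j := s)) i * V i \<omega>) = s * V j \<omega> + (\<Sum>i\<in>I. t i * V i \<omega>)" for \<omega>
        using insert.hyps by (simp add: sum.insert) (intro sum.cong, auto)
      then show "(LINT \<omega>|M. f \<omega> * cis (\<Sum>i\<in>I. t i * V i \<omega>) * cis (s * V j \<omega>)) = 0"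
        using insert.prems(3)[of "t(j := s)"] by (simp add: cis_mult mult.assoc add.commute)
    qed simp
    then show "(LINT \<omega>|M. f \<omega> * indicator (B j) (V j \<omega>) * cis (\<Sum>i\<in>I. t i * V i \<omega>)) = 0"
      by (simp add: mult_ac)
  qed (use insert.prems in auto)
  then show ?case using insert.hyps by (simp add: mult.assoc)
qed

text \<open>Frequencies are traded for indicators first in \<open>U\<close>, then in
  \<open>W\<close>. Each time, centring at the mean turns a product formula into a vanishing
  transform, and uniqueness applies.\<close>

lemma prob_rectangle_of_char_mult:
  fixes U :: "'i \<Rightarrow> 'a \<Rightarrow> real" and W :: "'j \<Rightarrow> 'a \<Rightarrow> real"
  assumes fin: "finite I" "finite J"
    and U: "\<And>i. i \<in> I \<Longrightarrow> U i \<in> borel_measurable M"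
    and W: "\<And>j. j \<in> J \<Longrightarrow> W j \<in> borel_measurable M"
    and A: "\<And>i. i \<in> I \<Longrightarrow> A i \<in> sets borel"
    and B: "\<And>j. j \<in> J \<Longrightarrow> B j \<in> sets borel"
    and mult: "\<And>a b. (LINT \<omega>|M. cis ((\<Sum>i\<in>I. a i * U i \<omega>) + (\<Sum>j\<in>J. b j * W j \<omega>))) =
      (LINT \<omega>|M. cis (\<Sum>i\<in>I. a i * U i \<omega>)) * (LINT \<omega>|M. cis (\<Sum>j\<in>J. b j * W j \<omega>))"
  shows "prob ({\<omega>\<in>space M. \<forall>i\<in>I. U i \<omega> \<in> A i} \<inter> {\<omega>\<in>space M. \<forall>j\<in>J. W j \<omega> \<in> B j}) =
    prob {\<omega>\<in>space M. \<forall>i\<in>I. U i \<omega> \<in> A i} * prob {\<omega>\<in>space M. \<forall>j\<in>J. W j \<omega> \<in> B j}"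
proof -
  note [measurable] = U W A B
  define R where "R = {\<omega>\<in>space M. \<forall>i\<in>I. U i \<omega> \<in> A i}"
  define S where "S = {\<omega>\<in>space M. \<forall>j\<in>J. W j \<omega> \<in> B j}"
  have [measurable]: "R \<in> sets M" "S \<in> sets M"
    unfolding R_def S_def using fin by measurable
  have one: "integrable M (\<lambda>\<omega>. 1 :: complex)" by simp
  have indR: "(\<Prod>i\<in>I. indicator (A i) (U i \<omega>)) = (indicator R \<omega> :: complex)" if "\<omega> \<in> space M" for \<omega>
    using fin that by (auto simp: R_def indicator_def prod_zero_iff)
  have indS: "(\<Prod>j\<in>J. indicator (B j) (W j \<omega>)) = (indicator S \<omega> :: complex)" if "\<omega> \<in> space M" for \<omega>
    using fin that by (auto simp: S_def indicator_def prod_zero_iff)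
  have cisU: "integrable M (\<lambda>\<omega>. cis (\<Sum>i\<in>I. a i * U i \<omega>))" for a
    using integrable_mult_cis[OF one, of "\<lambda>\<omega>. \<Sum>i\<in>I. a i * U i \<omega>"] by simp
  have cisW: "integrable M (\<lambda>\<omega>. cis (\<Sum>j\<in>J. b j * W j \<omega>))" for b
    using integrable_mult_cis[OF one, of "\<lambda>\<omega>. \<Sum>j\<in>J. b j * W j \<omega>"] by simp
  have iR: "integrable M (\<lambda>\<omega>. indicator R \<omega> :: complex)"
    by (rule Bochner_Integration.integrable_bound[OF one]) (auto simp: indicator_def)
  have iS: "integrable M (\<lambda>\<omega>. indicator S \<omega> :: complex)"
    by (rule Bochner_Integration.integrable_bound[OF one]) (auto simp: indicator_def)
  have iRW: "integrable M (\<lambda>\<omega>. indicator R \<omega> * cis (\<Sum>j\<in>J. b j * W j \<omega>))" for b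
    by (rule integrable_mult_cis[OF iR]) simp
  have iRS: "integrable M (\<lambda>\<omega>. indicator R \<omega> * indicator S \<omega> :: complex)"
    by (rule Bochner_Integration.integrable_bound[OF one]) (auto simp: indicator_def)
  have EX: "(LINT \<omega>|M. (indicator X \<omega> :: complex)) = of_real (prob X)" if [measurable]: "X \<in> sets M" for X
  proof -
    have "(LINT \<omega>|M. (indicator X \<omega> :: complex)) = (LINT \<omega>|M. complex_of_real (indicator X \<omega>))"
      by (rule Bochner_Integration.integral_cong) (auto simp: indicator_def)
    also have "\<dots> = of_real (LINT \<omega>|M. indicator X \<omega>)" 
      by (rule integral_of_real) (simp add: less_top[symmetric])
    finally show ?thesis by simp
  qed
  have step1: "(LINT \<omega>|M. indicator R \<omega> * cis (\<Sum>j\<in>J. b j * W j \<omega>)) =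
      of_real (prob R) * (LINT \<omega>|M. cis (\<Sum>j\<in>J. b j * W j \<omega>))" for b
  proof -
    define w where "w = (LINT \<omega>|M. cis (\<Sum>j\<in>J. b j * W j \<omega>))"
    have i: "integrable M (\<lambda>\<omega>. cis (\<Sum>j\<in>J. b j * W j \<omega>) - w)" using cisW by simp
    \<comment> \<open>The centred wave in \<open>W\<close> is the complex density; by the
      factorisation its transform in \<open>U\<close> vanishes.\<close>
    have "(LINT \<omega>|M. (cis (\<Sum>j\<in>J. b j * W j \<omega>) - w) * (\<Prod>i\<in>I. indicator (A i) (U i \<omega>))) = 0"
    proof (rule integral_rectangle_zero_of_char_zero[OF fin(1) i U])
      fix a
      have "(LINT \<omega>|M. (cis (\<Sum>j\<in>J. b j * W j \<omega>) - w) * cis (\<Sum>i\<in>I. a i * U i \<omega>)) =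
        (LINT \<omega>|M. cis ((\<Sum>i\<in>I. a i * U i \<omega>) + (\<Sum>j\<in>J. b j * W j \<omega>)) - w * cis (\<Sum>i\<in>I. a i * U i \<omega>))"
        by (simp add: algebra_simps cis_mult)
      also have "\<dots> = 0"
        using cisU integrable_mult_cis[OF cisU, of "\<lambda>\<omega>. \<Sum>j\<in>J. b j * W j \<omega>" a]
        by (subst Bochner_Integration.integral_diff) (auto simp: cis_mult mult w_def)
      finally show "(LINT \<omega>|M. (cis (\<Sum>j\<in>J. b j * W j \<omega>) - w) * cis (\<Sum>i\<in>I. a i * U i \<omega>)) = 0" .
    qed (use A in auto)
    also have "(LINT \<omega>|M. (cis (\<Sum>j\<in>J. b j * W j \<omega>) - w) * (\<Prod>i\<in>I. indicator (A i) (U i \<omega>))) =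
        (LINT \<omega>|M. indicator R \<omega> * cis (\<Sum>j\<in>J. b j * W j \<omega>) - w * indicator R \<omega>)"
      by (rule Bochner_Integration.integral_cong) (auto simp: indR algebra_simps)
    also have "\<dots> = (LINT \<omega>|M. indicator R \<omega> * cis (\<Sum>j\<in>J. b j * W j \<omega>)) - w * of_real (prob R)"
      using iR iRW by (simp add: EX)
    finally show ?thesis by (simp add: w_def mult.commute)
  qed
  have i: "integrable M (\<lambda>\<omega>. indicator R \<omega> - complex_of_real (prob R))" using iR by simp
  \<comment> \<open>Second pass: the centred indicator of \<open>R\<close> is the density, and
    \<open>step1\<close> makes its transform in \<open>W\<close> vanish.\<close>
  have "(LINT \<omega>|M. (indicator R \<omega> - complex_of_real (prob R)) * (\<Prod>j\<in>J. indicator (B j) (W j \<omega>))) = 0"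
  proof (rule integral_rectangle_zero_of_char_zero[OF fin(2) i W])
    fix b
    show "(LINT \<omega>|M. (indicator R \<omega> - complex_of_real (prob R)) * cis (\<Sum>j\<in>J. b j * W j \<omega>)) = 0"
      using iRW cisW by (simp add: algebra_simps step1)
  qed (use B in auto)
  also have "(LINT \<omega>|M. (indicator R \<omega> - complex_of_real (prob R)) * (\<Prod>j\<in>J. indicator (B j) (W j \<omega>))) =
      (LINT \<omega>|M. indicator R \<omega> * indicator S \<omega> - complex_of_real (prob R) * indicator S \<omega>)"
    by (rule Bochner_Integration.integral_cong) (auto simp: indS algebra_simps)
  also have "\<dots> = (LINT \<omega>|M. indicator (R \<inter> S) \<omega>) - complex_of_real (prob R) * of_real (prob S)"
    using iRS iS by (simp add: EX indicator_inter_arith)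
  also have "\<dots> = complex_of_real (prob (R \<inter> S) - prob R * prob S)"
    by (simp add: EX)
  finally have "prob (R \<inter> S) - prob R * prob S = 0"
    by (simp only: of_real_eq_0_iff)
  then show ?thesis by (simp add: R_def S_def)
qed

end

subsection \<open>The Gaussian space of a sequence\<close>

lemma borel_measurable_vec_nth:
  fixes f :: "'a \<Rightarrow> real ^ 'd"
  assumes "f \<in> borel_measurable M"
  shows "(\<lambda>\<omega>. f \<omega> $ i) \<in> borel_measurable M"
proof -
  have "(\<lambda>\<omega>. f \<omega> \<bullet> axis i 1) \<in> borel_measurable M" using assms by measurable
  then show ?thesis by (simp add: inner_axis)
qed

lemma borel_measurable_vec_iff:
  fixes f :: "'a \<Rightarrow> real ^ 'd"
  shows "f \<in> borel_measurable M \<longleftrightarrow> (\<forall>i. (\<lambda>\<omega>. f \<omega> $ i) \<in> borel_measurable M)"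
  by (auto simp: borel_measurable_euclidean_space[of f] Basis_vec_def inner_axis)

lemma borel_measurable_matrix_vector_mult:
  fixes f :: "'a \<Rightarrow> real ^ 'd" and A :: "real ^ 'd ^ 'd"
  assumes "f \<in> borel_measurable M"
  shows "(\<lambda>\<omega>. A *v f \<omega>) \<in> borel_measurable M"
  by (rule borel_measurable_continuous_on[OF matrix_vector_mult_linear_continuous_on assms])

lemma integrable_vec_nth:
  fixes f :: "'a \<Rightarrow> real ^ 'd"
  assumes "integrable M f"
  shows "integrable M (\<lambda>\<omega>. f \<omega> $ i)" "(LINT \<omega>|M. f \<omega> $ i) = (LINT \<omega>|M. f \<omega>) $ i"
  using integrable_inner_left[of "axis i 1" M f] integral_inner_left[of "axis i 1" M f] assms
  by (simp_all add: inner_axis)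

lemma integrable_vec_iff:
  fixes f :: "'a \<Rightarrow> real ^ 'd"
  shows "integrable M f \<longleftrightarrow> (\<forall>i. integrable M (\<lambda>\<omega>. f \<omega> $ i))"
proof
  assume *: "\<forall>i. integrable M (\<lambda>\<omega>. f \<omega> $ i)"
  have "integrable M (\<lambda>\<omega>. \<Sum>b\<in>Basis. (f \<omega> \<bullet> b) *\<^sub>R b)"
    using * by (intro Bochner_Integration.integrable_sum integrable_scaleR_left)
      (auto simp: Basis_vec_def inner_axis)
  then show "integrable M f" by (simp add: euclidean_representation)
qed (simp add: integrable_vec_nth)

section \<open>Second moments and transforms of univariate Gaussians\<close>

context prob_space
begin

lemma gaussian_rv_integrable_square:
  assumes "gaussian_rv M Y"
  shows "integrable M (\<lambda>\<omega>. (Y \<omega>)\<^sup>2)"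
  using assms unfolding gaussian_rv_def
proof (elim conjE disjE exE)
  fix \<mu> \<sigma> :: real assume \<sigma>: "0 < \<sigma>" and D: "distributed M lborel Y (normal_density \<mu> \<sigma>)"
  have i: "integrable lborel (\<lambda>x. normal_density \<mu> \<sigma> x * (x - \<mu>) ^ k)" for k
    by (rule integrable_normal_moment[OF \<sigma>])
  \<comment> \<open>Expanding the square about \<mu> reduces it to central moments of orders 2, 1
    and 0.\<close>
  have "integrable lborel (\<lambda>x. normal_density \<mu> \<sigma> x * (x - \<mu>) ^ 2
      + 2 * \<mu> * (normal_density \<mu> \<sigma> x * (x - \<mu>) ^ 1) + \<mu>\<^sup>2 * (normal_density \<mu> \<sigma> x * (x - \<mu>) ^ 0))"
    by (intro Bochner_Integration.integrable_add integrable_mult_right i)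
  also have "(\<lambda>x. normal_density \<mu> \<sigma> x * (x - \<mu>) ^ 2
      + 2 * \<mu> * (normal_density \<mu> \<sigma> x * (x - \<mu>) ^ 1) + \<mu>\<^sup>2 * (normal_density \<mu> \<sigma> x * (x - \<mu>) ^ 0)) =
      (\<lambda>x. normal_density \<mu> \<sigma> x * x\<^sup>2)"
    by (auto simp: fun_eq_iff algebra_simps power2_eq_square)
  finally show ?thesis
    using distributed_integrable[OF D, of "\<lambda>x. x\<^sup>2"] by simp
next
  fix \<mu> assume [measurable]: "Y \<in> borel_measurable M" and "AE \<omega> in M. Y \<omega> = \<mu>"
  then have "AE \<omega> in M. (Y \<omega>)\<^sup>2 = \<mu>\<^sup>2" by auto
  then show ?thesis by (subst integrable_cong_AE[where g = "\<lambda>_. \<mu>\<^sup>2"]) auto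
qed

text \<open>A scaled standard normal variable and a point mass at 0 obey the same formula, so the
  second moment alone fixes the transform. This is what turns uncorrelatedness into
  factorisation.\<close>

lemma expectation_cis_gaussian:
  assumes Y: "gaussian_rv M Y" and mean: "expectation Y = 0"
  shows "(LINT \<omega>|M. cis (Y \<omega>)) = exp (- complex_of_real (LINT \<omega>|M. (Y \<omega>)\<^sup>2) / 2)"
  using Y unfolding gaussian_rv_def
proof (elim conjE disjE exE)
  fix \<mu> \<sigma> :: real assume [measurable]: "Y \<in> borel_measurable M"
    and \<sigma>: "0 < \<sigma>" and D: "distributed M lborel Y (normal_density \<mu> \<sigma>)"
  have \<mu>: "\<mu> = 0" using normal_distributed_expectation[OF \<sigma> D] mean by simp
  have sq: "(LINT \<omega>|M. (Y \<omega>)\<^sup>2) = \<sigma>\<^sup>2" using normal_distributed_variance[OF \<sigma> D] mean by simp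
  have "distributed M lborel (\<lambda>\<omega>. Y \<omega> / \<sigma>) std_normal_density"
    using normal_standard_normal_convert[OF \<sigma>, of Y \<mu>] D \<mu> by simp
  then have "distr M lborel (\<lambda>\<omega>. Y \<omega> / \<sigma>) = std_normal_distribution"
    by (rule distributed_distr_eq_density)
  \<comment> \<open>The wave of \<open>Y\<close> is that of the standardised variable at frequency
    \<sigma>.\<close>
  then have "char std_normal_distribution \<sigma> = char (distr M lborel (\<lambda>\<omega>. Y \<omega> / \<sigma>)) \<sigma>" by simp
  also have "\<dots> = (LINT \<omega>|M. cis (Y \<omega>))"
    unfolding char_def using \<sigma> by (subst integral_distr) (auto simp: cis_conv_exp)
  finally show ?thesis
    by (simp add: char_std_normal_distribution sq flip: exp_of_real)
next
  fix \<mu> assume [measurable]: "Y \<in> borel_measurable M" and c: "AE \<omega> in M. Y \<omega> = \<mu>"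
  have "expectation Y = (LINT \<omega>|M. \<mu>)" by (rule integral_cong_AE) (use c in auto)
  then have \<mu>: "\<mu> = 0" using mean by (simp add: prob_space)
  have "(LINT \<omega>|M. cis (Y \<omega>)) = (LINT \<omega>|M. 1)"
    by (rule integral_cong_AE) (use c \<mu> in \<open>auto simp: cis_conv_exp\<close>)
  moreover have "(LINT \<omega>|M. (Y \<omega>)\<^sup>2) = (LINT \<omega>|M. 0)"
    by (rule integral_cong_AE) (use c \<mu> in auto)
  ultimately show ?thesis by (simp add: prob_space)
qed

end

section \<open>The linear span of the components\<close>

locale centered_gaussian_seq = prob_space M for M :: "'a measure" +
  fixes N :: nat and x :: "nat \<Rightarrow> 'a \<Rightarrow> real ^ 'd"
  assumes gaussian: "gaussian_seq M N x" and centered: "zero_mean_seq M N x"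
begin

text \<open>Membership is pointwise, not up to null sets. The noises of a given dynamic model agree
  with members of the span only almost surely, so residuals built from \<open>x\<close> stand in for
  them.\<close>

definition gspan :: "('a \<Rightarrow> real) \<Rightarrow> bool" where
  "gspan Y \<longleftrightarrow> (\<exists>a. Y = (\<lambda>\<omega>. \<Sum>k\<le>N. a k \<bullet> x k \<omega>))"

definition vspan :: "('a \<Rightarrow> real ^ 'd) \<Rightarrow> bool" where
  "vspan X \<longleftrightarrow> (\<forall>i. gspan (\<lambda>\<omega>. X \<omega> $ i))"

lemma measurable_x [measurable]: "k \<le> N \<Longrightarrow> x k \<in> borel_measurable M"
  using gaussian by (simp add: gaussian_seq_def)

lemma gspan_x: "k \<le> N \<Longrightarrow> gspan (\<lambda>\<omega>. x k \<omega> $ i)"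
  unfolding gspan_def
  by (rule exI[of _ "\<lambda>j. if j = k then axis i 1 else 0"])
    (simp add: if_distrib[of "\<lambda>v. v \<bullet> _"] inner_axis' cong: if_cong)

lemma gspan_add: "gspan Y \<Longrightarrow> gspan Z \<Longrightarrow> gspan (\<lambda>\<omega>. Y \<omega> + Z \<omega>)"
  unfolding gspan_def
proof (elim exE)
  fix a b assume "Y = (\<lambda>\<omega>. \<Sum>k\<le>N. a k \<bullet> x k \<omega>)" "Z = (\<lambda>\<omega>. \<Sum>k\<le>N. b k \<bullet> x k \<omega>)"
  then show "\<exists>c. (\<lambda>\<omega>. Y \<omega> + Z \<omega>) = (\<lambda>\<omega>. \<Sum>k\<le>N. c k \<bullet> x k \<omega>)"
    by (intro exI[of _ "\<lambda>k. a k + b k"]) (simp add: inner_add_left sum.distrib)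
qed

lemma gspan_scale: "gspan Y \<Longrightarrow> gspan (\<lambda>\<omega>. r * Y \<omega>)"
  unfolding gspan_def
proof (elim exE)
  fix a assume "Y = (\<lambda>\<omega>. \<Sum>k\<le>N. a k \<bullet> x k \<omega>)"
  then show "\<exists>c. (\<lambda>\<omega>. r * Y \<omega>) = (\<lambda>\<omega>. \<Sum>k\<le>N. c k \<bullet> x k \<omega>)"
    by (intro exI[of _ "\<lambda>k. r *\<^sub>R a k"]) (simp add: sum_distrib_left)
qed

lemma gspan_diff: "gspan Y \<Longrightarrow> gspan Z \<Longrightarrow> gspan (\<lambda>\<omega>. Y \<omega> - Z \<omega>)"
  using gspan_add[of Y "\<lambda>\<omega>. (-1) * Z \<omega>"] gspan_scale[of Z "-1"] by simp

lemma gspan_zero: "gspan (\<lambda>\<omega>. 0)"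
  unfolding gspan_def by (rule exI[of _ "\<lambda>_. 0"]) simp

lemma gspan_sum: "(\<And>i. i \<in> I \<Longrightarrow> gspan (Y i)) \<Longrightarrow> gspan (\<lambda>\<omega>. \<Sum>i\<in>I. Y i \<omega>)"
  by (induction I rule: infinite_finite_induct) (auto intro: gspan_zero gspan_add)

lemma gspan_gaussian: "gspan Y \<Longrightarrow> gaussian_rv M Y"
  using gaussian by (auto simp: gspan_def gaussian_seq_def)

lemma gspan_measurable: "gspan Y \<Longrightarrow> Y \<in> borel_measurable M"
  using gspan_gaussian by (auto simp: gaussian_rv_def)

lemma gspan_integrable_mult:
  assumes "gspan Y" "gspan Z"
  shows "integrable M (\<lambda>\<omega>. Y \<omega> * Z \<omega>)"
proof (rule Bochner_Integration.integrable_bound)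
  show "integrable M (\<lambda>\<omega>. (Y \<omega>)\<^sup>2 + (Z \<omega>)\<^sup>2)"
    using assms by (intro Bochner_Integration.integrable_add gaussian_rv_integrable_square gspan_gaussian)
  have "\<bar>y * z\<bar> \<le> y\<^sup>2 + z\<^sup>2" for y z :: real
  proof -
    have "2 * \<bar>y * z\<bar> \<le> y\<^sup>2 + z\<^sup>2"
      using sum_squares_bound[of "\<bar>y\<bar>" "\<bar>z\<bar>"] by (simp add: abs_mult mult.assoc)
    then show ?thesis using abs_ge_zero[of "y * z"] by linarith
  qed
  then show "AE \<omega> in M. norm (Y \<omega> * Z \<omega>) \<le> norm ((Y \<omega>)\<^sup>2 + (Z \<omega>)\<^sup>2)" by auto
qed (use assms gspan_measurable in auto)

lemma gspan_integrable: "gspan Y \<Longrightarrow> integrable M Y"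
  by (rule square_integrable_imp_integrable)
    (auto intro: gspan_measurable gaussian_rv_integrable_square gspan_gaussian)

lemma integrable_x: "k \<le> N \<Longrightarrow> integrable M (x k)"
  by (simp add: integrable_vec_iff gspan_integrable gspan_x)

lemma gspan_mean:
  assumes "gspan Y"
  shows "expectation Y = 0"
proof -
  obtain a where Y: "Y = (\<lambda>\<omega>. \<Sum>k\<le>N. a k \<bullet> x k \<omega>)" using assms by (auto simp: gspan_def)
  show ?thesis
    unfolding Y using centered
    by (subst Bochner_Integration.integral_sum) (auto simp: integrable_x zero_mean_seq_def)
qed

text \<open>Members of the span are centred, so on them this inner product is the covariance. It may
  be degenerate.\<close>

definition ip :: "('a \<Rightarrow> real) \<Rightarrow> ('a \<Rightarrow> real) \<Rightarrow> real" where
  "ip Y Z = (LINT \<omega>|M. Y \<omega> * Z \<omega>)"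

lemma ip_commute: "ip Y Z = ip Z Y"
  by (simp add: ip_def mult.commute)

lemma ip_add_left: "gspan Y \<Longrightarrow> gspan Z \<Longrightarrow> gspan U \<Longrightarrow> ip (\<lambda>\<omega>. Y \<omega> + Z \<omega>) U = ip Y U + ip Z U"
  by (simp add: ip_def distrib_right gspan_integrable_mult)

lemma ip_diff_left: "gspan Y \<Longrightarrow> gspan Z \<Longrightarrow> gspan U \<Longrightarrow> ip (\<lambda>\<omega>. Y \<omega> - Z \<omega>) U = ip Y U - ip Z U"
  by (simp add: ip_def left_diff_distrib gspan_integrable_mult)

lemma ip_scale_left: "ip (\<lambda>\<omega>. r * Y \<omega>) U = r * ip Y U"
  by (simp add: ip_def mult.assoc)

lemma ip_sum_left:
  assumes "\<And>i. i \<in> I \<Longrightarrow> gspan (Y i)" "gspan U"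
  shows "ip (\<lambda>\<omega>. \<Sum>i\<in>I. Y i \<omega>) U = (\<Sum>i\<in>I. ip (Y i) U)"
  using assms by (simp add: ip_def sum_distrib_right gspan_integrable_mult)

text \<open>A vector of zero length vanishes almost everywhere. This replaces definiteness of the
  inner product when covariances are singular.\<close>

lemma ip_zero_of_null:
  assumes "gspan Y" "gspan Z" "ip Z Z = 0"
  shows "ip Y Z = 0"
proof -
  note [measurable] = assms(1,2)[THEN gspan_measurable]
  have "AE \<omega> in M. Z \<omega> * Z \<omega> = 0"
    using integral_nonneg_eq_0_iff_AE[OF gspan_integrable_mult[OF assms(2,2)]] assms(3)
    by (simp add: ip_def)
  then have "(LINT \<omega>|M. Y \<omega> * Z \<omega>) = (LINT \<omega>|M. 0)"
    by (intro integral_cong_AE) auto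
  then show ?thesis by (simp add: ip_def)
qed

text \<open>Gram-Schmidt, one vector at a time: both \<open>y\<close> and the new vector
  \<open>f s\<close> are first reduced modulo \<open>K\<close>, then the reduced \<open>y\<close> is
  projected on the reduced \<open>f s\<close>. No Gram matrix is inverted, and the family may be
  linearly dependent.\<close>

lemma gspan_projection:
  assumes "finite K" "\<And>k. k \<in> K \<Longrightarrow> gspan (f k)" "gspan y"
  shows "\<exists>c. \<forall>s\<in>K. ip (\<lambda>\<omega>. y \<omega> - (\<Sum>k\<in>K. c k * f k \<omega>)) (f s) = 0"
  using assms
proof (induction K arbitrary: y rule: finite_induct)
  case empty
  then show ?case by simp
next
  case (insert s K)
  have f: "gspan (f s)" "\<And>k. k \<in> K \<Longrightarrow> gspan (f k)" using insert.prems by auto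
  obtain c1 where c1: "\<And>t. t \<in> K \<Longrightarrow> ip (\<lambda>\<omega>. y \<omega> - (\<Sum>k\<in>K. c1 k * f k \<omega>)) (f t) = 0"
    using insert.IH[OF f(2) insert.prems(2)] by auto
  obtain c2 where c2: "\<And>t. t \<in> K \<Longrightarrow> ip (\<lambda>\<omega>. f s \<omega> - (\<Sum>k\<in>K. c2 k * f k \<omega>)) (f t) = 0"
    using insert.IH[OF f(2) f(1)] by auto
  define r where "r = (\<lambda>\<omega>. y \<omega> - (\<Sum>k\<in>K. c1 k * f k \<omega>))"
  define s' where "s' = (\<lambda>\<omega>. f s \<omega> - (\<Sum>k\<in>K. c2 k * f k \<omega>))"
  have g: "gspan r" "gspan s'"
    unfolding r_def s'_def using f insert.prems(2) by (auto intro!: gspan_diff gspan_sum gspan_scale)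
  \<comment> \<open>if \<open>s'\<close> is null, the junk value \<open>l = 0\<close> is right, since then \<open>r\<close> is orthogonal to \<open>s'\<close> anyway\<close>
  define l where "l = ip r s' / ip s' s'"
  define u where "u = (\<lambda>\<omega>. r \<omega> - l * s' \<omega>)"
  have gu: "gspan u" unfolding u_def by (intro gspan_diff gspan_scale g)
  have uK: "ip u (f t) = 0" if "t \<in> K" for t
    using c1[OF that] c2[OF that] f(2)[OF that] g
    by (simp add: u_def ip_diff_left gspan_scale ip_scale_left r_def[symmetric] s'_def[symmetric])
  have us': "ip s' u = 0"
  proof -
    have "ip u s' = ip r s' - l * ip s' s'"
      using g by (simp add: u_def ip_diff_left gspan_scale ip_scale_left)
    then show ?thesis
      using ip_zero_of_null[OF g] ip_commute[of s' u]
      by (cases "ip s' s' = 0") (simp_all add: l_def)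
  qed
  \<comment> \<open>\<open>f s\<close> differs from \<open>s'\<close> by a combination of vectors
    from \<open>K\<close>, and \<open>u\<close> is orthogonal to all of these.\<close>
  have us: "ip u (f s) = 0"
  proof -
    have "ip (f s) u = ip (\<lambda>\<omega>. s' \<omega> + (\<Sum>k\<in>K. c2 k * f k \<omega>)) u" by (simp add: s'_def)
    also have "\<dots> = ip s' u + (\<Sum>k\<in>K. c2 k * ip (f k) u)"
      using g gu f by (simp add: ip_add_left gspan_sum gspan_scale ip_sum_left ip_scale_left)
    also have "\<dots> = 0" using us' uK ip_commute[of _ u] by (simp cong: sum.cong)
    finally show ?thesis using ip_commute[of u "f s"] by simp
  qed
  \<comment> \<open>Coefficients read off from \<open>r - l * s'\<close> after expanding both
    reductions.\<close>
  define c where "c = (\<lambda>k. if k = s then l else c1 k - l * c2 k)"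
  have "(\<Sum>k\<in>insert s K. c k * f k \<omega>) = l * f s \<omega> + (\<Sum>k\<in>K. (c1 k - l * c2 k) * f k \<omega>)" for \<omega>
    using insert.hyps by (simp add: c_def) (intro sum.cong, auto)
  then have "u = (\<lambda>\<omega>. y \<omega> - (\<Sum>k\<in>insert s K. c k * f k \<omega>))"
    by (simp add: fun_eq_iff u_def r_def s'_def left_diff_distrib right_diff_distrib sum_subtractf
        sum_distrib_left mult.assoc)
  then have "\<forall>t\<in>insert s K. ip (\<lambda>\<omega>. y \<omega> - (\<Sum>k\<in>insert s K. c k * f k \<omega>)) (f t) = 0"
    using us uK by auto
  then show ?case by blast
qed

text \<open>On \<open>vspan\<close> this is the vanishing of the cross covariance matrix; written
  with \<open>ip\<close>, it inherits linearity without any centring.\<close>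

definition orth :: "('a \<Rightarrow> real ^ 'd) \<Rightarrow> ('a \<Rightarrow> real ^ 'd) \<Rightarrow> bool" where
  "orth X Y \<longleftrightarrow> (\<forall>i j. ip (\<lambda>\<omega>. X \<omega> $ i) (\<lambda>\<omega>. Y \<omega> $ j) = 0)"

section \<open>Random vectors in the span and their orthogonality\<close>

lemma vspan_x: "k \<le> N \<Longrightarrow> vspan (x k)"
  by (simp add: vspan_def gspan_x)

lemma vspan_add: "vspan X \<Longrightarrow> vspan Y \<Longrightarrow> vspan (\<lambda>\<omega>. X \<omega> + Y \<omega>)"
  by (simp add: vspan_def gspan_add)

lemma vspan_diff: "vspan X \<Longrightarrow> vspan Y \<Longrightarrow> vspan (\<lambda>\<omega>. X \<omega> - Y \<omega>)"
  by (simp add: vspan_def gspan_diff)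

lemma vspan_mult: "vspan X \<Longrightarrow> vspan (\<lambda>\<omega>. A *v X \<omega>)"
  by (simp add: vspan_def matrix_vector_mult_def gspan_sum gspan_scale)

lemma vspan_sum: "(\<And>i. i \<in> I \<Longrightarrow> vspan (X i)) \<Longrightarrow> vspan (\<lambda>\<omega>. \<Sum>i\<in>I. X i \<omega>)"
  by (simp add: vspan_def gspan_sum)

lemma vspan_measurable: "vspan X \<Longrightarrow> X \<in> borel_measurable M"
  by (simp add: vspan_def borel_measurable_vec_iff gspan_measurable)

lemma vspan_integrable: "vspan X \<Longrightarrow> integrable M X"
  by (simp add: vspan_def integrable_vec_iff gspan_integrable)

lemma vspan_mean: "vspan X \<Longrightarrow> integral\<^sup>L M X = 0"
  using vspan_integrable[of X]
  by (simp add: vec_eq_iff vspan_def gspan_mean flip: integrable_vec_nth(2))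

lemma gspan_inner: "vspan X \<Longrightarrow> gspan (\<lambda>\<omega>. a \<bullet> X \<omega>)"
  by (simp add: inner_vec_def vspan_def gspan_sum gspan_scale)

lemma orth_commute: "orth X Y \<longleftrightarrow> orth Y X"
  unfolding orth_def by (subst ip_commute) blast

lemma orth_add: "vspan X \<Longrightarrow> vspan Y \<Longrightarrow> vspan Z \<Longrightarrow> orth X Z \<Longrightarrow> orth Y Z \<Longrightarrow> orth (\<lambda>\<omega>. X \<omega> + Y \<omega>) Z"
  by (simp add: orth_def vspan_def ip_add_left)

lemma orth_diff: "vspan X \<Longrightarrow> vspan Y \<Longrightarrow> vspan Z \<Longrightarrow> orth X Z \<Longrightarrow> orth Y Z \<Longrightarrow> orth (\<lambda>\<omega>. X \<omega> - Y \<omega>) Z"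
  by (simp add: orth_def vspan_def ip_diff_left)

lemma orth_mult: "vspan X \<Longrightarrow> vspan Z \<Longrightarrow> orth X Z \<Longrightarrow> orth (\<lambda>\<omega>. A *v X \<omega>) Z"
  by (simp add: orth_def vspan_def matrix_vector_mult_def ip_sum_left gspan_scale ip_scale_left)

lemma orth_sum:
  "(\<And>i. i \<in> I \<Longrightarrow> vspan (X i)) \<Longrightarrow> vspan Z \<Longrightarrow> (\<And>i. i \<in> I \<Longrightarrow> orth (X i) Z) \<Longrightarrow>
    orth (\<lambda>\<omega>. \<Sum>i\<in>I. X i \<omega>) Z"
  by (simp add: orth_def vspan_def ip_sum_left)

lemma orth_iff_cross_cov:
  assumes "vspan X" "vspan Y"
  shows "orth X Y \<longleftrightarrow> cross_cov M X Y = 0"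
  using assms by (simp add: orth_def cross_cov_def vspan_mean ip_def vec_eq_iff)

text \<open>Each coordinate \<open>l\<close> of \<open>X\<close> is projected on the scalar family
  indexed by pairs (time, coordinate); the coefficients obtained are the entries in row
  \<open>l\<close> of the matrices.\<close>

lemma projection:
  assumes X: "vspan X" and I: "I \<subseteq> {..N}"
  shows "\<exists>A :: nat \<Rightarrow> real ^ 'd ^ 'd. \<forall>i\<in>I. orth (\<lambda>\<omega>. X \<omega> - (\<Sum>i\<in>I. A i *v x i \<omega>)) (x i)"
proof -
  have fin: "finite I" using I finite_subset by blast
  have "\<exists>c. \<forall>s\<in>I \<times> UNIV. ip (\<lambda>\<omega>. X \<omega> $ l - (\<Sum>p\<in>I \<times> UNIV. c p * x (fst p) \<omega> $ snd p))
      (\<lambda>\<omega>. x (fst s) \<omega> $ snd s) = 0" for l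
    by (rule gspan_projection) (use fin I X in \<open>auto simp: gspan_x vspan_def\<close>)
  then have "\<forall>l. \<exists>c. \<forall>s\<in>I \<times> UNIV. ip (\<lambda>\<omega>. X \<omega> $ l - (\<Sum>p\<in>I \<times> UNIV. c p * x (fst p) \<omega> $ snd p))
      (\<lambda>\<omega>. x (fst s) \<omega> $ snd s) = 0" by blast
  from choice[OF this] obtain c where
    c': "\<forall>l. \<forall>s\<in>I \<times> UNIV. ip (\<lambda>\<omega>. X \<omega> $ l - (\<Sum>p\<in>I \<times> UNIV. c l p * x (fst p) \<omega> $ snd p))
      (\<lambda>\<omega>. x (fst s) \<omega> $ snd s) = 0" by blast
  have c: "ip (\<lambda>\<omega>. X \<omega> $ l - (\<Sum>p\<in>I \<times> UNIV. c l p * x (fst p) \<omega> $ snd p)) (\<lambda>\<omega>. x i \<omega> $ j) = 0"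
    if "i \<in> I" for l i j
    using c'[rule_format, of "(i, j)" l] that by simp
  have "(\<Sum>i\<in>I. (\<chi> l j. c l (i, j)) *v x i \<omega>) $ l = (\<Sum>p\<in>I \<times> UNIV. c l p * x (fst p) \<omega> $ snd p)" for l \<omega>
    by (simp add: matrix_vector_mult_def sum.cartesian_product split_def)
  then show ?thesis
    using c by (intro exI[of _ "\<lambda>i. \<chi> l j. c l (i, j)"]) (simp add: orth_def)
qed

end

subsection \<open>Conditional distribution functions and independence\<close>

context prob_space
begin

text \<open>Weighting by the positive and by the negative part of \<open>f\<close> and pushing
  forward by \<open>X\<close> gives two finite measures that agree on lower orthants. They are
  therefore equal and integrate \<phi> alike.\<close>

lemma expectation_mult_zero_of_cdf_zero:
  fixes X :: "'a \<Rightarrow> real ^ 'd" and f :: "'a \<Rightarrow> real" and \<phi> :: "real ^ 'd \<Rightarrow> real"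
  assumes f: "integrable M f" and X: "X \<in> borel_measurable M"
    and zero: "\<And>\<xi>. (LINT \<omega>|M. f \<omega> * indicator {..\<xi>} (X \<omega>)) = 0"
    and \<phi>: "\<phi> \<in> borel_measurable borel" and int: "integrable M (\<lambda>\<omega>. f \<omega> * \<phi> (X \<omega>))"
  shows "(LINT \<omega>|M. f \<omega> * \<phi> (X \<omega>)) = 0"
proof -
  note [measurable] = X \<phi> borel_measurable_integrable[OF f]
  define p n where "p = (\<lambda>\<omega>. max (f \<omega>) 0)" and "n = (\<lambda>\<omega>. max (- f \<omega>) 0)"
  have fpn: "f \<omega> = p \<omega> - n \<omega>" for \<omega> by (simp add: p_def n_def)
  have pn: "integrable M p" "integrable M n"
    using f by (auto simp: p_def n_def)
  note [measurable] = borel_measurable_integrable[OF pn(1)] borel_measurable_integrable[OF pn(2)]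
  have nonneg: "0 \<le> p \<omega>" "0 \<le> n \<omega>" for \<omega> by (auto simp: p_def n_def)
  have le: "p \<omega> \<le> \<bar>f \<omega>\<bar>" "n \<omega> \<le> \<bar>f \<omega>\<bar>" for \<omega> by (auto simp: p_def n_def)
  define \<nu> where "\<nu> q = distr (density M (\<lambda>\<omega>. ennreal (q \<omega>))) borel X" for q
  have em: "emeasure (\<nu> q) {..\<xi>} = ennreal (LINT \<omega>|M. q \<omega> * indicator {..\<xi>} (X \<omega>))"
    if q: "integrable M q" "\<And>\<omega>. 0 \<le> q \<omega>" for q \<xi>
  proof -
    have [measurable]: "q \<in> borel_measurable M" using q by auto
    have "emeasure (\<nu> q) {..\<xi>} = (\<integral>\<^sup>+\<omega>. ennreal (q \<omega>) * indicator (X -` {..\<xi>} \<inter> space M) \<omega> \<partial>M)"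
      unfolding \<nu>_def by (simp add: emeasure_distr emeasure_density)
    also have "\<dots> = (\<integral>\<^sup>+\<omega>. ennreal (q \<omega> * indicator {..\<xi>} (X \<omega>)) \<partial>M)"
      by (rule nn_integral_cong) (auto simp: indicator_def)
    also have "\<dots> = ennreal (LINT \<omega>|M. q \<omega> * indicator {..\<xi>} (X \<omega>))"
      using q by (intro nn_integral_eq_integral integrable_mult_indicator_vimage[OF q(1) X]) auto
    finally show ?thesis .
  qed
  have eq: "(LINT \<omega>|M. p \<omega> * indicator {..\<xi>} (X \<omega>)) = (LINT \<omega>|M. n \<omega> * indicator {..\<xi>} (X \<omega>))" for \<xi>
  proof -
    have i: "integrable M (\<lambda>\<omega>. p \<omega> * indicator {..\<xi>} (X \<omega>))" "integrable M (\<lambda>\<omega>. n \<omega> * indicator {..\<xi>} (X \<omega>))"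
      by (intro integrable_mult_indicator_vimage[OF _ X] pn; simp)+
    have "(LINT \<omega>|M. f \<omega> * indicator {..\<xi>} (X \<omega>)) =
      (LINT \<omega>|M. p \<omega> * indicator {..\<xi>} (X \<omega>)) - (LINT \<omega>|M. n \<omega> * indicator {..\<xi>} (X \<omega>))"
      by (subst Bochner_Integration.integral_diff[OF i, symmetric]) (simp add: fpn algebra_simps)
    then show ?thesis using zero[of \<xi>] by simp
  qed
  have "\<nu> p = \<nu> n"
  \<comment> \<open>Lower orthants are an intersection-stable generator of the Borel sets; those
    with corner (n, ..., n) have finite mass and exhaust the space.\<close>
  proof (rule measure_eqI_generator_eq[where E = "range (\<lambda>a. {..a})" and \<Omega> = UNIV
        and A = "\<lambda>n. {..(\<chi> i. real n) :: real ^ 'd}"])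
    show "Int_stable (range (\<lambda>a :: real ^ 'd. {..a}))"
    proof (rule Int_stableI_image)
      fix a b :: "real ^ 'd"
      show "\<exists>c\<in>UNIV. {..a} \<inter> {..b} = {..c}"
        by (intro bexI[of _ "\<chi> i. min (a $ i) (b $ i)"]) (auto simp: less_eq_vec_def)
    qed
    show "emeasure (\<nu> p) S = emeasure (\<nu> n) S" if "S \<in> range (\<lambda>a. {..a})" for S
      using that em[OF pn(1)] em[OF pn(2)] nonneg eq by auto
    show "sets (\<nu> p) = sigma_sets UNIV (range (\<lambda>a. {..a}))"
      "sets (\<nu> n) = sigma_sets UNIV (range (\<lambda>a. {..a}))"
      unfolding \<nu>_def by (subst sets_distr, subst borel_eq_atMost, simp)+
    show "(\<Union>i. {..(\<chi> j. real i) :: real ^ 'd}) = UNIV"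
    proof (intro UNIV_eq_I[symmetric] UN_I)
      fix v :: "real ^ 'd"
      have "v $ j \<le> real (nat \<lceil>norm v\<rceil>)" for j
        using component_le_norm_cart[of v j] real_nat_ceiling_ge[of "norm v"] by linarith
      then show "v \<in> {..(\<chi> j. real (nat \<lceil>norm v\<rceil>))}" by (simp add: less_eq_vec_def)
    qed simp
    show "emeasure (\<nu> p) {..(\<chi> j. real i) :: real ^ 'd} \<noteq> \<infinity>" for i
      using em[OF pn(1)] nonneg by simp
  qed auto
  then have eq\<phi>: "integral\<^sup>L (\<nu> p) \<phi> = integral\<^sup>L (\<nu> n) \<phi>" by simp
  have int_\<nu>: "integral\<^sup>L (\<nu> q) \<phi> = (LINT \<omega>|M. q \<omega> * \<phi> (X \<omega>))"
    if [measurable]: "q \<in> borel_measurable M" and q: "\<And>\<omega>. 0 \<le> q \<omega>" for q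
    unfolding \<nu>_def using q
    by (subst integral_distr, simp, simp, subst integral_density) auto
  have i: "integrable M (\<lambda>\<omega>. p \<omega> * \<phi> (X \<omega>))" "integrable M (\<lambda>\<omega>. n \<omega> * \<phi> (X \<omega>))"
    by (rule Bochner_Integration.integrable_bound[OF int];
        use nonneg le in \<open>auto simp: abs_mult intro!: mult_right_mono\<close>)+
  have "(LINT \<omega>|M. f \<omega> * \<phi> (X \<omega>)) = (LINT \<omega>|M. p \<omega> * \<phi> (X \<omega>)) - (LINT \<omega>|M. n \<omega> * \<phi> (X \<omega>))"
    by (subst Bochner_Integration.integral_diff[OF i, symmetric]) (simp add: fpn algebra_simps)
  then show ?thesis using eq\<phi> int_\<nu>[of p] int_\<nu>[of n] nonneg by simp
qed

section \<open>Sigma-algebras generated by states\<close>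

lemma sets_generated_by:
  "sets (generated_by M x I) = sigma_sets (space M) (\<Union>i\<in>I. {x i -` A \<inter> space M | A. A \<in> sets borel})"
  unfolding generated_by_def by (rule sets_measure_of) auto

lemma space_generated_by [simp]: "space (generated_by M x I) = space M"
  unfolding generated_by_def by (rule space_measure_of) auto

lemma generated_by_subset:
  assumes "space M' = space M" "\<And>i. i \<in> I \<Longrightarrow> x i \<in> borel_measurable M'"
  shows "sets (generated_by M x I) \<subseteq> sets M'"
  unfolding sets_generated_by assms(1)[symmetric]
  by (rule sets.sigma_sets_subset) (auto intro: measurable_sets assms(2))

lemma subalgebra_generated_by:
  "(\<And>i. i \<in> I \<Longrightarrow> x i \<in> borel_measurable M) \<Longrightarrow> subalgebra M (generated_by M x I)"
  by (simp add: subalgebra_def generated_by_subset)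

lemma measurable_generated_by:
  "i \<in> I \<Longrightarrow> x i \<in> borel_measurable (generated_by M x I)"
  by (rule measurableI) (auto simp: sets_generated_by)

lemma sigma_finite_subalgebraI: "subalgebra M F \<Longrightarrow> sigma_finite_subalgebra M F"
  by (rule finite_measure_subalgebra_is_sigma_finite)
    (simp add: finite_measure_subalgebra_def finite_measure_subalgebra_axioms_def finite_measure_axioms)

text \<open>Freezing: given \<open>F\<close>, the value of \<open>L\<close> is known and only the
  law of \<open>w\<close> is averaged. The result depends on \<open>F\<close> only through
  \<open>L\<close>, which allows two different sigma-algebras to be compared.\<close>

lemma cond_cdf_indep:
  fixes L w :: "'a \<Rightarrow> real ^ 'd"
  assumes sub: "subalgebra M F" and w: "w \<in> borel_measurable M"
    and indep: "indep_set (sets F) (sets (vimage_algebra (space M) w borel))"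
    and L: "L \<in> borel_measurable F"
  shows "AE \<omega> in M. cond_cdf M F (\<lambda>\<omega>. L \<omega> + w \<omega>) \<xi> \<omega> = measure (distr M borel w) {y. L \<omega> + y \<le> \<xi>}"
proof -
  interpret F: sigma_finite_subalgebra M F by (rule sigma_finite_subalgebraI[OF sub])
  have spF: "space F = space M" using sub by (simp add: subalgebra_def)
  \<comment> \<open>The identity, seen as a random element with values in the space carrying
    \<open>F\<close>, encodes all of \<open>F\<close> at once. Independence then says that its joint
    law with \<open>w\<close> is a product.\<close>
  have rv: "(\<lambda>\<omega>. \<omega>) \<in> measurable M F"
    using sub by (intro measurableI) (auto simp: subalgebra_def Int_absorb2 dest: sets.sets_into_space)
  note [measurable] = rv w L
  have LM [measurable]: "L \<in> borel_measurable M" by (rule measurable_from_subalg[OF sub L])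
  define \<mu> where "\<mu> = distr M borel w"
  interpret \<mu>: prob_space \<mu> unfolding \<mu>_def by (rule prob_space_distr) simp
  interpret D: prob_space "distr M F (\<lambda>\<omega>. \<omega>)" by (rule prob_space_distr) simp
  interpret P: pair_prob_space "distr M F (\<lambda>\<omega>. \<omega>)" \<mu> ..
  have [measurable_cong]: "sets \<mu> = sets borel" by (simp add: \<mu>_def)
  have joint: "distr M F (\<lambda>\<omega>. \<omega>) \<Otimes>\<^sub>M \<mu> = distr M (F \<Otimes>\<^sub>M borel) (\<lambda>\<omega>. (\<omega>, w \<omega>))"
  proof (rule pair_measure_eqI)
    show "sigma_finite_measure (distr M F (\<lambda>\<omega>. \<omega>))" "sigma_finite_measure \<mu>"
      by unfold_locales
    show "sets (distr M F (\<lambda>\<omega>. \<omega>) \<Otimes>\<^sub>M \<mu>) = sets (distr M (F \<Otimes>\<^sub>M borel) (\<lambda>\<omega>. (\<omega>, w \<omega>)))"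
      by (simp add: \<mu>_def cong: sets_pair_measure_cong)
    fix A B assume "A \<in> sets (distr M F (\<lambda>\<omega>. \<omega>))" "B \<in> sets \<mu>"
    then have A: "A \<in> sets F" and B: "B \<in> sets borel" by (simp_all add: \<mu>_def)
    note [measurable] = A B
    have "w -` B \<inter> space M \<in> sets (vimage_algebra (space M) w borel)"
      using B by (rule in_vimage_algebra)
    then have "prob (A \<inter> (w -` B \<inter> space M)) = prob A * prob (w -` B \<inter> space M)"
      by (rule indep_setD[OF indep A])
    moreover have "(\<lambda>\<omega>. (\<omega>, w \<omega>)) -` (A \<times> B) \<inter> space M = A \<inter> (w -` B \<inter> space M)" by auto
    moreover have "A \<inter> space M = A" using sets.sets_into_space[OF A] spF by auto
    ultimately show "emeasure (distr M F (\<lambda>\<omega>. \<omega>)) A * emeasure \<mu> B =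
        emeasure (distr M (F \<Otimes>\<^sub>M borel) (\<lambda>\<omega>. (\<omega>, w \<omega>))) (A \<times> B)"
      unfolding \<mu>_def by (simp add: emeasure_distr emeasure_eq_measure ennreal_mult)
  qed
  \<comment> \<open>The distribution function for a frozen value \<open>l\<close>; its measurability
    is that of the section measures of the set in \<open>Q\<close>.\<close>
  define h where "h l = measure \<mu> {y. l + y \<le> \<xi>}" for l :: "real ^ 'd"
  have atMost [measurable]: "{..\<xi>} \<in> sets borel" by simp
  have Q: "{p :: (real ^ 'd) \<times> (real ^ 'd). fst p + snd p \<in> {..\<xi>}} \<in> sets (borel \<Otimes>\<^sub>M \<mu>)"
  proof -
    have "(\<lambda>p. fst p + snd p) -` {..\<xi>} \<inter> space (borel \<Otimes>\<^sub>M \<mu>) \<in> sets (borel \<Otimes>\<^sub>M \<mu>)"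
      by (rule measurable_sets[OF _ atMost]) measurable
    then show ?thesis by (simp add: space_pair_measure \<mu>_def vimage_def)
  qed
  have h [measurable]: "h \<in> borel_measurable borel"
    using \<mu>.measurable_emeasure_Pair[OF Q] unfolding h_def measure_def by (simp add: vimage_def)
  have hh: "(LINT y|\<mu>. indicator {..\<xi>} (l + y)) = h l" for l
  proof -
    have [measurable]: "{y. l + y \<le> \<xi>} \<in> sets \<mu>"
    proof -
      have "(\<lambda>y. l + y) -` {..\<xi>} \<inter> space \<mu> \<in> sets \<mu>" by (rule measurable_sets[OF _ atMost]) measurable
      then show ?thesis by (simp add: \<mu>_def vimage_def)
    qed
    have "(LINT y|\<mu>. indicator {..\<xi>} (l + y)) = (LINT y|\<mu>. indicat_real {y. l + y \<le> \<xi>} y)"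
      by (rule Bochner_Integration.integral_cong) (auto simp: indicator_def)
    then show ?thesis by (simp add: h_def)
  qed
  have set_M [measurable]: "{\<omega> \<in> space M. L \<omega> + w \<omega> \<le> \<xi>} \<in> sets M"
  proof -
    have "(\<lambda>\<omega>. L \<omega> + w \<omega>) -` {..\<xi>} \<inter> space M \<in> sets M" by (rule measurable_sets[OF _ atMost]) measurable
    then show ?thesis by (simp add: vimage_def Int_def conj_commute)
  qed
  show ?thesis
    unfolding cond_cdf_def \<mu>_def[symmetric] h_def[symmetric]
  proof (rule F.real_cond_exp_charact)
    fix A assume A [measurable]: "A \<in> sets F"
    have AM [measurable]: "A \<in> sets M" using A sub by (auto simp: subalgebra_def)
    let ?g = "\<lambda>p :: 'a \<times> (real ^ 'd). indicator A (fst p) * (indicator {..\<xi>} (L (fst p) + snd p) :: real)"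
    have g [measurable]: "?g \<in> borel_measurable (F \<Otimes>\<^sub>M borel)" by measurable
    have gi: "integrable (distr M F (\<lambda>\<omega>. \<omega>) \<Otimes>\<^sub>M \<mu>) ?g"
      by (rule P.P.integrable_const_bound[where B = 1]) (auto simp: indicator_def)
    have "(LINT \<omega>:A|M. indicator {\<omega> \<in> space M. L \<omega> + w \<omega> \<le> \<xi>} \<omega>) = (LINT \<omega>|M. ?g (\<omega>, w \<omega>))"
      unfolding set_lebesgue_integral_def by (rule Bochner_Integration.integral_cong) (auto simp: indicator_def)
    also have "\<dots> = integral\<^sup>L (distr M (F \<Otimes>\<^sub>M borel) (\<lambda>\<omega>. (\<omega>, w \<omega>))) ?g"
      by (subst integral_distr) auto
    also have "\<dots> = integral\<^sup>L (distr M F (\<lambda>\<omega>. \<omega>) \<Otimes>\<^sub>M \<mu>) ?g" by (simp only: joint)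
    \<comment> \<open>Fubini on the product law: with the first component frozen, the inner integral
      is \<open>h\<close> at \<open>L\<close>.\<close>
    also have "\<dots> = (LINT \<omega>|distr M F (\<lambda>\<omega>. \<omega>). LINT y|\<mu>. ?g (\<omega>, y))"
      using P.integral_fst'[OF gi] by simp
    also have "\<dots> = (LINT \<omega>|distr M F (\<lambda>\<omega>. \<omega>). indicator A \<omega> * h (L \<omega>))"
      by (simp add: hh)
    also have "\<dots> = (LINT \<omega>|M. indicator A \<omega> * h (L \<omega>))"
      by (subst integral_distr) auto
    also have "\<dots> = (LINT \<omega>:A|M. h (L \<omega>))" by (simp add: set_lebesgue_integral_def)
    finally show "(LINT \<omega>:A|M. indicator {\<omega> \<in> space M. L \<omega> + w \<omega> \<le> \<xi>} \<omega>) = (LINT \<omega>:A|M. h (L \<omega>))" .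
  next
    show "integrable M (indicator {\<omega> \<in> space M. L \<omega> + w \<omega> \<le> \<xi>} :: 'a \<Rightarrow> real)"
      by (simp add: less_top[symmetric])
    show "integrable M (\<lambda>\<omega>. h (L \<omega>))"
    proof (rule integrable_const_bound[where B = 1])
      show "AE \<omega> in M. norm (h (L \<omega>)) \<le> 1" by (simp add: h_def)
    qed measurable
    show "(\<lambda>\<omega>. h (L \<omega>)) \<in> borel_measurable F" by measurable
  qed
qed

end

section \<open>Uncorrelated jointly Gaussian vectors are independent\<close>

context centered_gaussian_seq
begin

text \<open>Orthogonality makes the variances of combinations of the states and of \<open>w\<close>
  add up, so their characteristic functions multiply. This gives independence on coordinate
  rectangles, which extends to the generated sigma-algebras.\<close>

lemma indep_generated_by:
  assumes w: "vspan w" and I: "I \<subseteq> {..N}" and orth: "\<And>i. i \<in> I \<Longrightarrow> orth (x i) w"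
  shows "indep_set (sets (generated_by M x I)) (sets (vimage_algebra (space M) w borel))"
proof -
  have fin: "finite I" using I finite_subset by blast
  have xI: "x i \<in> borel_measurable M" if "i \<in> I" for i using I that measurable_x by auto
  have wM: "w \<in> borel_measurable M" by (rule vspan_measurable[OF w])
  \<comment> \<open>\<open>P\<close> and \<open>Q\<close> are the coordinate rectangles of the
    states and of \<open>w\<close>: intersection-stable families, fine enough to generate both
    sigma-algebras.\<close>
  define P where "P = {{\<omega>\<in>space M. \<forall>p\<in>I \<times> (UNIV :: 'd set). x (fst p) \<omega> $ snd p \<in> A p} | A. \<forall>p. A p \<in> sets (borel :: real measure)}"
  define Q where "Q = {{\<omega>\<in>space M. \<forall>j\<in>(UNIV :: 'd set). w \<omega> $ j \<in> B j} | B. \<forall>j. B j \<in> sets (borel :: real measure)}"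
  have ch: "(LINT \<omega>|M. cis ((\<Sum>p\<in>I \<times> UNIV. a p * x (fst p) \<omega> $ snd p) + (\<Sum>j\<in>UNIV. b j * w \<omega> $ j))) =
      (LINT \<omega>|M. cis (\<Sum>p\<in>I \<times> UNIV. a p * x (fst p) \<omega> $ snd p)) * (LINT \<omega>|M. cis (\<Sum>j\<in>UNIV. b j * w \<omega> $ j))"
    for a b
  proof -
    define S where "S = (\<lambda>\<omega>. \<Sum>p\<in>I \<times> UNIV. a p * x (fst p) \<omega> $ snd p)"
    define T where "T = (\<lambda>\<omega>. \<Sum>j\<in>UNIV. b j * w \<omega> $ j)"
    have S: "gspan S" unfolding S_def using I by (auto intro!: gspan_sum gspan_scale gspan_x)
    have T: "gspan T" unfolding T_def using w by (auto intro!: gspan_sum gspan_scale simp: vspan_def)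
    have "ip S T = 0"
    proof -
      have "ip S T = (\<Sum>p\<in>I \<times> UNIV. a p * ip (\<lambda>\<omega>. x (fst p) \<omega> $ snd p) T)"
        unfolding S_def using I T
        by (subst ip_sum_left) (auto intro!: sum.cong gspan_scale gspan_x simp: ip_scale_left)
      also have "\<dots> = 0"
      proof (rule sum.neutral, safe)
        fix i and l :: 'd assume i: "i \<in> I"
        then have xi: "gspan (\<lambda>\<omega>. x i \<omega> $ l)" using I by (auto intro: gspan_x)
        have "ip T (\<lambda>\<omega>. x i \<omega> $ l) = (\<Sum>j\<in>UNIV. b j * ip (\<lambda>\<omega>. w \<omega> $ j) (\<lambda>\<omega>. x i \<omega> $ l))"
          unfolding T_def using w xi
          by (subst ip_sum_left) (auto intro!: sum.cong gspan_scale simp: ip_scale_left vspan_def)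
        also have "\<dots> = 0" using orth[OF i, unfolded orth_commute[of "x i" w]] by (simp add: orth_def)
        finally show "a (i, l) * ip (\<lambda>\<omega>. x (fst (i, l)) \<omega> $ snd (i, l)) T = 0"
          by (simp add: ip_commute[of _ T])
      qed
      finally show ?thesis .
    qed
    then have ST: "(LINT \<omega>|M. S \<omega> * T \<omega>) = 0" by (simp add: ip_def)
    \<comment> \<open>The mixed term is twice the covariance of \<open>S\<close> and
      \<open>T\<close>, which is zero.\<close>
    have "(LINT \<omega>|M. (S \<omega> + T \<omega>)\<^sup>2) = (LINT \<omega>|M. S \<omega> * S \<omega> + 2 * (S \<omega> * T \<omega>) + T \<omega> * T \<omega>)"
      by (simp add: power2_eq_square algebra_simps)
    also have "\<dots> = (LINT \<omega>|M. S \<omega> * S \<omega>) + 2 * (LINT \<omega>|M. S \<omega> * T \<omega>) + (LINT \<omega>|M. T \<omega> * T \<omega>)"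
      using gspan_integrable_mult[OF S S] gspan_integrable_mult[OF S T] gspan_integrable_mult[OF T T] by simp
    finally have "(LINT \<omega>|M. (S \<omega> + T \<omega>)\<^sup>2) = (LINT \<omega>|M. (S \<omega>)\<^sup>2) + (LINT \<omega>|M. (T \<omega>)\<^sup>2)"
      by (simp add: ST power2_eq_square)
    moreover have "exp (- complex_of_real (a + b) / 2) = exp (- complex_of_real a / 2) * exp (- complex_of_real b / 2)"
      for a b by (simp add: exp_add[symmetric] diff_divide_distrib)
    ultimately have "(LINT \<omega>|M. cis (S \<omega> + T \<omega>)) = (LINT \<omega>|M. cis (S \<omega>)) * (LINT \<omega>|M. cis (T \<omega>))"
      using gspan_add[OF S T] S T by (simp only: expectation_cis_gaussian gspan_gaussian gspan_mean)
    then show ?thesis by (simp only: S_def T_def)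
  qed
  have "indep_set P Q"
  proof (rule indep_setI)
    have pre: "{\<omega>\<in>space M. f \<omega> \<in> B} \<in> events" if "f \<in> borel_measurable M" "B \<in> sets borel"
      for f :: "'a \<Rightarrow> real" and B
      using measurable_sets[OF that] by (simp add: vimage_def Int_def conj_commute)
    show "P \<subseteq> events"
      unfolding P_def
    proof clarify
      fix A :: "nat \<times> 'd \<Rightarrow> real set" assume A: "\<forall>p. A p \<in> sets borel"
      show "{\<omega>\<in>space M. \<forall>p\<in>I \<times> (UNIV :: 'd set). x (fst p) \<omega> $ snd p \<in> A p} \<in> events"
      proof (rule sets.sets_Collect_finite_All)
        fix p assume "p \<in> I \<times> (UNIV :: 'd set)"
        then have "x (fst p) \<in> borel_measurable M" using xI by auto
        then show "{\<omega>\<in>space M. x (fst p) \<omega> $ snd p \<in> A p} \<in> events"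
          by (intro pre borel_measurable_vec_nth A[rule_format])
      qed (use fin in auto)
    qed
    show "Q \<subseteq> events"
      unfolding Q_def
    proof clarify
      fix B :: "'d \<Rightarrow> real set" assume B: "\<forall>j. B j \<in> sets borel"
      show "{\<omega>\<in>space M. \<forall>j\<in>(UNIV :: 'd set). w \<omega> $ j \<in> B j} \<in> events"
        by (rule sets.sets_Collect_finite_All) (use B wM in \<open>auto intro!: pre borel_measurable_vec_nth\<close>)
    qed
    fix X Y assume "X \<in> P" "Y \<in> Q"
    then obtain A B where X: "X = {\<omega>\<in>space M. \<forall>p\<in>I \<times> (UNIV :: 'd set). x (fst p) \<omega> $ snd p \<in> A p}"
      and A: "\<And>p. A p \<in> sets borel"
      and Y: "Y = {\<omega>\<in>space M. \<forall>j\<in>(UNIV :: 'd set). w \<omega> $ j \<in> B j}" and B: "\<And>j. B j \<in> sets borel"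
      unfolding P_def Q_def by blast
    show "prob (X \<inter> Y) = prob X * prob Y"
      unfolding X Y
    proof (rule prob_rectangle_of_char_mult)
      show "(\<lambda>\<omega>. x (fst p) \<omega> $ snd p) \<in> borel_measurable M" if "p \<in> I \<times> (UNIV :: 'd set)" for p
        using that xI by (intro borel_measurable_vec_nth) auto
      show "(\<lambda>\<omega>. w \<omega> $ j) \<in> borel_measurable M" for j using wM by (rule borel_measurable_vec_nth)
    qed (use fin A B ch in simp_all)
  qed
  moreover have "Int_stable P"
    unfolding Int_stable_def P_def
  proof clarify
    fix A B :: "nat \<times> 'd \<Rightarrow> real set" assume "\<forall>p. A p \<in> sets borel" "\<forall>p. B p \<in> sets borel"
    then show "\<exists>C. {\<omega>\<in>space M. \<forall>p\<in>I \<times> UNIV. x (fst p) \<omega> $ snd p \<in> A p} \<inter>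
        {\<omega>\<in>space M. \<forall>p\<in>I \<times> UNIV. x (fst p) \<omega> $ snd p \<in> B p} =
        {\<omega>\<in>space M. \<forall>p\<in>I \<times> UNIV. x (fst p) \<omega> $ snd p \<in> C p} \<and> (\<forall>p. C p \<in> sets borel)"
      by (intro exI[of _ "\<lambda>p. A p \<inter> B p"]) auto
  qed
  moreover have "Int_stable Q"
    unfolding Int_stable_def Q_def
  proof clarify
    fix A B :: "'d \<Rightarrow> real set" assume "\<forall>p. A p \<in> sets borel" "\<forall>p. B p \<in> sets borel"
    then show "\<exists>C. {\<omega>\<in>space M. \<forall>j\<in>UNIV. w \<omega> $ j \<in> A j} \<inter> {\<omega>\<in>space M. \<forall>j\<in>UNIV. w \<omega> $ j \<in> B j} =
        {\<omega>\<in>space M. \<forall>j\<in>UNIV. w \<omega> $ j \<in> C j} \<and> (\<forall>j. C j \<in> sets borel)"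
      by (intro exI[of _ "\<lambda>p. A p \<inter> B p"]) auto
  qed
  ultimately have ind: "indep_set (sigma_sets (space M) P) (sigma_sets (space M) Q)"
    by (rule indep_set_sigma_sets)
  have PP: "P \<subseteq> Pow (space M)" "Q \<subseteq> Pow (space M)" by (auto simp: P_def Q_def)
  have xP: "x i \<in> borel_measurable (sigma (space M) P)" if "i \<in> I" for i
    unfolding borel_measurable_vec_iff
  proof (intro allI measurableI)
    fix l and B :: "real set" assume B: "B \<in> sets borel"
    \<comment> \<open>A condition on one coordinate is a rectangle whose other sides are the whole
      line.\<close>
    have "(\<lambda>\<omega>. x i \<omega> $ l) -` B \<inter> space M = {\<omega>\<in>space M. \<forall>p\<in>I \<times> (UNIV :: 'd set). x (fst p) \<omega> $ snd p \<in> (if p = (i, l) then B else UNIV)}"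
      (is "_ = ?R")
    proof
      show "?R \<subseteq> (\<lambda>\<omega>. x i \<omega> $ l) -` B \<inter> space M"
      proof
        fix \<omega> assume "\<omega> \<in> ?R"
        then have "\<omega> \<in> space M"
          and "x (fst (i, l)) \<omega> $ snd (i, l) \<in> (if (i, l) = (i, l) then B else UNIV)"
          using that by blast+
        then show "\<omega> \<in> (\<lambda>\<omega>. x i \<omega> $ l) -` B \<inter> space M" by simp
      qed
    qed auto
    also have "\<dots> \<in> P" unfolding P_def using B
      by (intro CollectI exI[of _ "\<lambda>p. if p = (i, l) then B else UNIV"]) simp
    finally show "(\<lambda>\<omega>. x i \<omega> $ l) -` B \<inter> space (sigma (space M) P) \<in> sets (sigma (space M) P)"
      using PP by (simp add: sigma_sets.Basic)
  qed simp
  have wQ: "w \<in> borel_measurable (sigma (space M) Q)"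
    unfolding borel_measurable_vec_iff
  proof (intro allI measurableI)
    fix l and B :: "real set" assume B: "B \<in> sets borel"
    have "(\<lambda>\<omega>. w \<omega> $ l) -` B \<inter> space M = {\<omega>\<in>space M. \<forall>j\<in>(UNIV :: 'd set). w \<omega> $ j \<in> (if j = l then B else UNIV)}"
      by auto
    also have "\<dots> \<in> Q" unfolding Q_def using B
      by (intro CollectI exI[of _ "\<lambda>j. if j = l then B else UNIV"]) simp
    finally show "(\<lambda>\<omega>. w \<omega> $ l) -` B \<inter> space (sigma (space M) Q) \<in> sets (sigma (space M) Q)"
      using PP by (simp add: sigma_sets.Basic)
  qed simp
  have sub1: "sets (generated_by M x I) \<subseteq> sigma_sets (space M) P"
    using generated_by_subset[of "sigma (space M) P" I x] xP PP by simp
  have "{w -` A \<inter> space M | A. A \<in> sets borel} \<subseteq> sets (sigma (space M) Q)"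
    using measurable_sets[OF wQ] by (auto simp: space_measure_of_conv)
  then have sub2: "sets (vimage_algebra (space M) w borel) \<subseteq> sigma_sets (space M) Q"
    unfolding sets_vimage_algebra using sets.sigma_sets_subset[of _ "sigma (space M) Q"] PP by simp
  show ?thesis
    using indep_setD_ev1[OF ind] indep_setD_ev2[OF ind] sub1 sub2
    by (intro indep_setI indep_setD[OF ind]) blast+
qed

subsection \<open>Orthogonality to the past\<close>

text \<open>The noise that the recursion forces for given matrices. Being built from
  \<open>x\<close>, it belongs to the span pointwise.\<close>

definition residual :: "nat \<Rightarrow> (nat \<Rightarrow> nat \<Rightarrow> real ^ 'd ^ 'd) \<Rightarrow> nat \<Rightarrow> 'a \<Rightarrow> real ^ 'd" where
  "residual c G k \<omega> = x k \<omega> - G k (k - 1) *v x (k - 1) \<omega> - G k c *v x c \<omega>"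

text \<open>The common core of both models, free of boundary matrices. The index \<open>c\<close> is
  added to the past because for \<open>c = N\<close> it lies in the future of
  \<open>k\<close>.\<close>

definition innovative :: "nat \<Rightarrow> (nat \<Rightarrow> nat \<Rightarrow> real ^ 'd ^ 'd) \<Rightarrow> bool" where
  "innovative c G \<longleftrightarrow> (\<forall>k\<in>{1..N} - {c}. \<forall>i\<in>insert c {..<k}. orth (residual c G k) (x i))"

lemma vspan_residual: "c \<le> N \<Longrightarrow> k \<le> N \<Longrightarrow> vspan (residual c G k)"
  unfolding residual_def[abs_def] by (intro vspan_diff vspan_mult vspan_x) auto

text \<open>Induction on \<open>k\<close>, starting at \<open>j\<close>: each step of the recursion
  multiplies the old noise by a matrix and adds a residual, both orthogonal to the states up to
  \<open>j\<close> and to \<open>x c\<close>.\<close>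

lemma conditional_representation:
  assumes c: "c \<le> N" and G: "innovative c G" and k: "j \<le> k" "k \<le> N"
  shows "\<exists>A B w. vspan w \<and> (\<forall>i\<in>insert c {..j}. orth w (x i)) \<and>
    x k = (\<lambda>\<omega>. (A *v x j \<omega> + B *v x c \<omega>) + w \<omega>)"
  using k
proof (induction k rule: dec_induct)
  case base
  show ?case
    by (intro exI[of _ "mat 1"] exI[of _ 0] exI[of _ "\<lambda>_. 0"])
      (simp add: orth_def ip_def vspan_def gspan_zero)
next
  case (step n)
  then obtain A B w where w: "vspan w" "\<And>i. i \<in> insert c {..j} \<Longrightarrow> orth w (x i)"
    and xn: "x n = (\<lambda>\<omega>. (A *v x j \<omega> + B *v x c \<omega>) + w \<omega>)"
    by auto
  show ?case
  \<comment> \<open>No recursion holds at time \<open>c\<close>, but there \<open>x c\<close>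
    represents itself without noise.\<close>
  proof (cases "Suc n = c")
    case True
    then show ?thesis
      by (intro exI[of _ 0] exI[of _ "mat 1"] exI[of _ "\<lambda>_. 0"])
        (simp add: orth_def ip_def vspan_def gspan_zero)
  next
    case False
    let ?r = "residual c G (Suc n)" and ?F = "G (Suc n) n" and ?H = "G (Suc n) c"
    have r: "vspan ?r" using vspan_residual[OF c step.prems] .
    have "x (Suc n) \<omega> = (((?F ** A) *v x j \<omega> + (?F ** B + ?H) *v x c \<omega>) + (?F *v w \<omega> + ?r \<omega>))" for \<omega>
      using fun_cong[OF xn, of \<omega>]
      by (simp add: residual_def matrix_vector_right_distrib matrix_vector_mult_add_rdistrib
          matrix_vector_mul_assoc)
    moreover have "vspan (\<lambda>\<omega>. ?F *v w \<omega> + ?r \<omega>)" using w r by (intro vspan_add vspan_mult)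
    moreover have "orth (\<lambda>\<omega>. ?F *v w \<omega> + ?r \<omega>) (x i)" if i: "i \<in> insert c {..j}" for i
    proof (intro orth_add orth_mult vspan_mult w r)
      show "vspan (x i)" using i c step by (auto intro: vspan_x)
      then show "vspan (x i)" .
      show "i \<in> insert c {..j}" by (fact i)
      show "orth ?r (x i)"
      proof -
        have "i \<in> insert c {..<Suc n}" "Suc n \<in> {1..N} - {c}" using i False step by auto
        then show ?thesis using G unfolding innovative_def by blast
      qed
    qed
    ultimately show ?thesis by (intro exI conjI ballI) (auto simp: fun_eq_iff)
  qed
qed

text \<open>The same noise \<open>w\<close> is independent of the full past with \<open>x c\<close>
  and of the pair at \<open>j\<close> and \<open>c\<close>. Freezing yields the same function of
  that pair for both conditional distribution functions.\<close>

lemma CM_seq_of_innovative: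
  assumes c: "c \<le> N" and G: "innovative c G"
  shows "CM_seq M N c x"
  unfolding CM_seq_def
proof (intro allI impI)
  fix j k \<xi> assume jk: "j < k" "k \<le> N"
  obtain A B w where w: "vspan w" "\<And>i. i \<in> insert c {..j} \<Longrightarrow> orth w (x i)"
    and xk: "x k = (\<lambda>\<omega>. (A *v x j \<omega> + B *v x c \<omega>) + w \<omega>)"
    using conditional_representation[OF c G less_imp_le[OF jk(1)] jk(2)] by blast
  have *: "AE \<omega> in M. cond_cdf M (generated_by M x I) (x k) \<xi> \<omega> =
      measure (distr M borel w) {y. (A *v x j \<omega> + B *v x c \<omega>) + y \<le> \<xi>}"
    if I: "{j, c} \<subseteq> I" "I \<subseteq> insert c {..j}" for I
  proof -
    have IN: "I \<subseteq> {..N}" using I c jk by auto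
    have L: "(\<lambda>\<omega>. A *v x j \<omega> + B *v x c \<omega>) \<in> borel_measurable (generated_by M x I)"
      using I by (intro borel_measurable_add borel_measurable_matrix_vector_mult measurable_generated_by) auto
    have sub: "subalgebra M (generated_by M x I)"
      by (rule subalgebra_generated_by) (use IN in \<open>auto intro: measurable_x\<close>)
    have ind: "indep_set (sets (generated_by M x I)) (sets (vimage_algebra (space M) w borel))"
      by (rule indep_generated_by[OF w(1) IN]) (use w(2) I in \<open>auto simp: orth_commute[of _ w]\<close>)
    show ?thesis
      using cond_cdf_indep[OF sub vspan_measurable[OF w(1)] ind L, of \<xi>] by (simp add: xk[symmetric])
  qed
  show "AE \<omega> in M. cond_cdf M (generated_by M x ({0..j} \<union> {c})) (x k) \<xi> \<omega> =
      cond_cdf M (generated_by M x {j, c}) (x k) \<xi> \<omega>"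
    using *[of "{0..j} \<union> {c}"] *[of "{j, c}"] by (auto simp: subset_iff)
qed

text \<open>Against \<open>Z\<close>, an event of \<open>x k\<close> may be replaced by its
  conditional probability given the past, hence by that given the pair at \<open>j\<close> and
  \<open>c\<close>. The latter is independent of the centred \<open>Z\<close>, so the expectation
  vanishes.\<close>

lemma orth_of_CM_seq:
  assumes c: "c \<le> N" and CM: "CM_seq M N c x" and jk: "j < k" "k \<le> N" and i: "i \<le> j"
    and Z: "Z = (\<lambda>\<omega>. x i \<omega> - (\<Sum>l\<in>{j, c}. P l *v x l \<omega>))"
    and oZ: "orth Z (x j)" "orth Z (x c)"
  shows "orth Z (x k)"
proof -
  let ?F = "generated_by M x ({0..j} \<union> {c})" and ?H = "generated_by M x {j, c}"
  have subF: "subalgebra M ?F"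
    by (rule subalgebra_generated_by) (use c jk in \<open>auto intro: measurable_x\<close>)
  have subH: "subalgebra M ?H"
    by (rule subalgebra_generated_by) (use c jk in \<open>auto intro: measurable_x\<close>)
  interpret F: sigma_finite_subalgebra M ?F by (rule sigma_finite_subalgebraI[OF subF])
  interpret H: sigma_finite_subalgebra M ?H by (rule sigma_finite_subalgebraI[OF subH])
  have vZ: "vspan Z" unfolding Z using c jk i by (intro vspan_diff vspan_sum vspan_mult vspan_x) auto
  have ZF: "Z \<in> borel_measurable ?F"
  proof -
    have "x l \<in> borel_measurable ?F" if "l \<in> {0..j} \<union> {c}" for l
      using that by (rule measurable_generated_by)
    then show ?thesis
      unfolding Z using i
      by (intro borel_measurable_diff borel_measurable_sum borel_measurable_matrix_vector_mult) auto
  qed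
  have ind: "indep_set (sets ?H) (sets (vimage_algebra (space M) Z borel))"
    by (rule indep_generated_by[OF vZ]) (use c jk oZ in \<open>auto simp: orth_commute[of _ Z]\<close>)
  have xk: "x k \<in> borel_measurable M" using jk by (auto intro: measurable_x)
  have zero: "(LINT \<omega>|M. Z \<omega> $ m * indicator {..\<xi>} (x k \<omega>)) = 0" for m \<xi>
  proof -
    let ?S = "{\<omega> \<in> space M. x k \<omega> \<le> \<xi>}"
    have S: "?S \<in> sets M"
      using measurable_sets[OF xk, of "{..\<xi>}"] by (simp add: vimage_def Int_def conj_commute)
    note [measurable] = S
    have Zm: "(\<lambda>\<omega>. Z \<omega> $ m) \<in> borel_measurable ?F" using ZF by (rule borel_measurable_vec_nth)
    have gZ: "gspan (\<lambda>\<omega>. Z \<omega> $ m)" using vZ by (simp add: vspan_def)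
    have iZ: "integrable M (\<lambda>\<omega>. Z \<omega> $ m)" using gZ by (rule gspan_integrable)
    have iZS: "integrable M (\<lambda>\<omega>. Z \<omega> $ m * indicator ?S \<omega>)"
      by (rule Bochner_Integration.integrable_bound[OF iZ]) (use iZ in \<open>auto simp: indicator_def\<close>)
    have iS: "integrable M (indicator ?S :: 'a \<Rightarrow> real)" by (simp add: less_top[symmetric])
    define h where "h = real_cond_exp M ?H (indicator ?S)"
    have hH: "h \<in> borel_measurable ?H" unfolding h_def by simp
    have hM: "h \<in> borel_measurable M" unfolding h_def by simp
    have ih: "integrable M h" unfolding h_def using iS by (rule H.real_cond_exp_int)
    have "AE \<omega> in M. real_cond_exp M ?F (indicator ?S) \<omega> = h \<omega>"
      using CM jk unfolding CM_seq_def cond_cdf_def h_def by blast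
    then have "(LINT \<omega>|M. Z \<omega> $ m * real_cond_exp M ?F (indicator ?S) \<omega>) = (LINT \<omega>|M. Z \<omega> $ m * h \<omega>)"
      using iZ hM by (intro integral_cong_AE) auto
    \<comment> \<open>\<open>Z\<close> is a function of the past and of \<open>x c\<close>, so it
      passes through the conditional expectation.\<close>
    moreover have "(LINT \<omega>|M. Z \<omega> $ m * real_cond_exp M ?F (indicator ?S) \<omega>) = (LINT \<omega>|M. Z \<omega> $ m * indicator ?S \<omega>)"
      by (rule F.real_cond_exp_intg(2)[OF iZS Zm]) measurable
    \<comment> \<open>\<open>h\<close> is measurable for the sigma-algebra of the pair, of which
      \<open>Z\<close> is independent by orthogonality.\<close>
    moreover have "(LINT \<omega>|M. h \<omega> * Z \<omega> $ m) = (LINT \<omega>|M. h \<omega>) * (LINT \<omega>|M. Z \<omega> $ m)"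
    proof (rule indep_var_lebesgue_integral[OF _ ih iZ])
      have Zv: "(\<lambda>\<omega>. Z \<omega> $ m) \<in> borel_measurable (vimage_algebra (space M) Z borel)"
        by (intro borel_measurable_vec_nth measurable_vimage_algebra1) simp
      have s1: "sigma_sets (space M) {h -` A \<inter> space M | A. A \<in> sets borel} \<subseteq> sets ?H"
        using measurable_sets[OF hH] sets.sigma_sets_subset[of "{h -` A \<inter> space M | A. A \<in> sets borel}" ?H] by auto
      have s2: "sigma_sets (space M) {(\<lambda>\<omega>. Z \<omega> $ m) -` A \<inter> space M | A. A \<in> sets borel} \<subseteq>
          sets (vimage_algebra (space M) Z borel)"
        using measurable_sets[OF Zv]
          sets.sigma_sets_subset[of "{(\<lambda>\<omega>. Z \<omega> $ m) -` A \<inter> space M | A. A \<in> sets borel}" "vimage_algebra (space M) Z borel"]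
        by auto
      show "indep_var borel h borel (\<lambda>\<omega>. Z \<omega> $ m)"
        unfolding indep_var_eq
        using hM iZ indep_setD_ev1[OF ind] indep_setD_ev2[OF ind] s1 s2
        by (intro conjI indep_setI indep_setD[OF ind]) (simp, simp, blast+)
    qed
    moreover have "(LINT \<omega>|M. Z \<omega> $ m * indicator ?S \<omega>) = (LINT \<omega>|M. Z \<omega> $ m * indicator {..\<xi>} (x k \<omega>))"
      by (rule Bochner_Integration.integral_cong) (auto simp: indicator_def)
    ultimately show ?thesis using gspan_mean[OF gZ] by (simp add: mult.commute)
  qed
  show ?thesis
    unfolding orth_def ip_def
  proof (intro allI)
    fix m l
    have gZ: "gspan (\<lambda>\<omega>. Z \<omega> $ m)" using vZ by (simp add: vspan_def)
    show "(LINT \<omega>|M. Z \<omega> $ m * x k \<omega> $ l) = 0"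
    \<comment> \<open>From events to moments: \<phi> is the unbounded coordinate map, integrable
      against \<open>Z\<close> by square integrability.\<close>
    proof (rule expectation_mult_zero_of_cdf_zero[OF gspan_integrable[OF gZ] xk zero])
      show "(\<lambda>v :: real ^ 'd. v $ l) \<in> borel_measurable borel" by (rule borel_measurable_vec_nth) simp
      show "integrable M (\<lambda>\<omega>. Z \<omega> $ m * x k \<omega> $ l)"
        using gZ gspan_x[OF jk(2)] by (rule gspan_integrable_mult)
    qed
  qed
qed

text \<open>The matrices come from projecting \<open>x k\<close> on the pair at \<open>k - 1\<close>
  and \<open>c\<close>. Any other past state is a combination of that pair plus a remainder
  \<open>Z\<close>, and the residual of \<open>x k\<close> is orthogonal to both.\<close>

lemma innovative_of_CM_seq:
  assumes c: "c \<le> N" and CM: "CM_seq M N c x"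
  shows "\<exists>G. innovative c G"
proof -
  have "\<exists>g :: nat \<Rightarrow> real ^ 'd ^ 'd. \<forall>i\<in>insert c {..<k}.
      orth (\<lambda>\<omega>. x k \<omega> - g (k - 1) *v x (k - 1) \<omega> - g c *v x c \<omega>) (x i)"
    if k: "k \<in> {1..N} - {c}" for k
  proof -
    have sub: "{k - 1, c} \<subseteq> {..N}" using k c by auto
    have kN: "k \<le> N" "k - 1 < k" "k - 1 \<le> N" using k by auto
    obtain A where A: "\<And>l. l \<in> {k - 1, c} \<Longrightarrow> orth (\<lambda>\<omega>. x k \<omega> - (\<Sum>l\<in>{k - 1, c}. A l *v x l \<omega>)) (x l)"
      using projection[OF vspan_x[OF kN(1)] sub] by blast
    define r where "r = (\<lambda>\<omega>. x k \<omega> - (\<Sum>l\<in>{k - 1, c}. A l *v x l \<omega>))"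
    have vr: "vspan r" unfolding r_def using sub kN by (intro vspan_diff vspan_sum vspan_mult vspan_x) auto
    have Ar: "orth (x l) r" if "l \<in> {k - 1, c}" for l
      using A[OF that] orth_commute[of r "x l"] by (simp add: r_def)
    have r: "orth r (x i)" if i: "i \<in> insert c {..<k}" for i
    proof (cases "i \<in> {k - 1, c}")
      case True
      then show ?thesis unfolding r_def by (rule A)
    next
      case False
      then have i': "i \<le> k - 1" "i \<le> N" using i k by auto
      obtain P where P: "\<And>l. l \<in> {k - 1, c} \<Longrightarrow> orth (\<lambda>\<omega>. x i \<omega> - (\<Sum>l\<in>{k - 1, c}. P l *v x l \<omega>)) (x l)"
        using projection[OF vspan_x[OF i'(2)] sub] by blast
      define Z where "Z = (\<lambda>\<omega>. x i \<omega> - (\<Sum>l\<in>{k - 1, c}. P l *v x l \<omega>))"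
      have vZ: "vspan Z" unfolding Z_def using sub i' by (intro vspan_diff vspan_sum vspan_mult vspan_x) auto
      have oZ: "orth Z (x l)" if "l \<in> {k - 1, c}" for l using P[OF that] by (simp add: Z_def)
      have "orth Z (x k)"
        using orth_of_CM_seq[OF c CM kN(2,1) i'(1) Z_def] oZ by simp
      \<comment> \<open>\<open>r\<close> combines \<open>x k\<close> with the pair: \<open>Z\<close>
        is orthogonal to \<open>x k\<close> by the conditional Markov property and to the pair by
        construction.\<close>
      then have "orth r Z"
        unfolding r_def using sub kN vZ oZ
        by (intro orth_diff orth_sum orth_mult vspan_sum vspan_mult vspan_x)
          (auto simp: orth_commute[of _ Z])
      then have "orth Z r" by (simp add: orth_commute[of Z])
      then have "orth (\<lambda>\<omega>. Z \<omega> + (\<Sum>l\<in>{k - 1, c}. P l *v x l \<omega>)) r"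
        using sub vZ vr Ar
        by (intro orth_add orth_sum orth_mult vspan_sum vspan_mult vspan_x) auto
      then have "orth (x i) r" by (simp add: Z_def)
      then show ?thesis by (simp add: orth_commute[of r])
    qed
    show ?thesis
    proof (cases "k - 1 = c")
      case True
      \<comment> \<open>the two matrices share the index pair \<open>(k, c)\<close> and act on the same vector, so each gets half\<close>
      then have "r = (\<lambda>\<omega>. x k \<omega> - ((1/2) *\<^sub>R A c) *v x c \<omega> - ((1/2) *\<^sub>R A c) *v x c \<omega>)"
        by (auto simp: r_def fun_eq_iff scaleR_matrix_vector_assoc[symmetric] simp flip: scaleR_left.add)
      then show ?thesis using r True by (intro exI[of _ "\<lambda>_. (1/2) *\<^sub>R A c"]) auto
    next
      case False
      then have "r = (\<lambda>\<omega>. x k \<omega> - A (k - 1) *v x (k - 1) \<omega> - A c *v x c \<omega>)"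
        by (auto simp: r_def fun_eq_iff)
      then show ?thesis using r by (intro exI[of _ A]) auto
    qed
  qed
  then have "\<forall>k. \<exists>g :: nat \<Rightarrow> real ^ 'd ^ 'd. k \<in> {1..N} - {c} \<longrightarrow> (\<forall>i\<in>insert c {..<k}.
      orth (\<lambda>\<omega>. x k \<omega> - g (k - 1) *v x (k - 1) \<omega> - g c *v x c \<omega>) (x i))"
    by blast
  from choice[OF this] obtain G :: "nat \<Rightarrow> nat \<Rightarrow> real ^ 'd ^ 'd" where
    "\<forall>k. k \<in> {1..N} - {c} \<longrightarrow> (\<forall>i\<in>insert c {..<k}.
      orth (\<lambda>\<omega>. x k \<omega> - G k (k - 1) *v x (k - 1) \<omega> - G k c *v x c \<omega>) (x i))" by blast
  then show ?thesis unfolding innovative_def residual_def[abs_def] by blast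
qed

end

subsection \<open>Dynamic models\<close>

lemma cross_cov_cong_AE:
  fixes X X' Y Y' :: "'a \<Rightarrow> real ^ 'd"
  assumes X: "AE \<omega> in M. X \<omega> = X' \<omega>" and Y: "AE \<omega> in M. Y \<omega> = Y' \<omega>"
    and meas: "X \<in> borel_measurable M" "X' \<in> borel_measurable M" "Y \<in> borel_measurable M" "Y' \<in> borel_measurable M"
  shows "cross_cov M X Y = cross_cov M X' Y'"
proof -
  have m: "integral\<^sup>L M X = integral\<^sup>L M X'" "integral\<^sup>L M Y = integral\<^sup>L M Y'"
    using X Y meas by (auto intro: integral_cong_AE)
  note [measurable] = meas[THEN borel_measurable_vec_nth]
  show ?thesis
    unfolding cross_cov_def m vec_eq_iff vec_lambda_beta vector_minus_component
    using X Y by (intro allI integral_cong_AE) auto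
qed

section \<open>White noise and orthogonality\<close>

context centered_gaussian_seq
begin

text \<open>\<open>X\<close> and \<open>Y\<close> are versions of two noises inside the span;
  covariances do not see the null sets on which they differ.\<close>

lemma orth_of_white:
  assumes e: "white_gaussian_seq M N e" and kj: "k \<le> N" "j \<le> N" "k \<noteq> j"
    and X: "vspan X" "AE \<omega> in M. X \<omega> = e k \<omega>" and Y: "vspan Y" "AE \<omega> in M. Y \<omega> = e j \<omega>"
  shows "orth X Y"
proof -
  have "cross_cov M X Y = cross_cov M (e k) (e j)"
    using e kj by (intro cross_cov_cong_AE X(2) Y(2) vspan_measurable[OF X(1)] vspan_measurable[OF Y(1)])
      (auto simp: white_gaussian_seq_def gaussian_seq_def)
  then show ?thesis using e kj X Y by (simp add: orth_iff_cross_cov white_gaussian_seq_def)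
qed

lemma white_of_orth:
  assumes v: "\<And>k. k \<le> N \<Longrightarrow> vspan (e k)"
    and o: "\<And>k j. k \<le> N \<Longrightarrow> j \<le> N \<Longrightarrow> k \<noteq> j \<Longrightarrow> orth (e k) (e j)"
  shows "white_gaussian_seq M N e" "zero_mean_seq M N e"
proof -
  have "gaussian_rv M (\<lambda>\<omega>. \<Sum>k\<le>N. a k \<bullet> e k \<omega>)" for a
    by (intro gspan_gaussian gspan_sum gspan_inner v) simp
  then show "white_gaussian_seq M N e" "zero_mean_seq M N e"
    using v o by (auto simp: white_gaussian_seq_def gaussian_seq_def zero_mean_seq_def
        vspan_measurable vspan_mean simp flip: orth_iff_cross_cov)
qed

text \<open>Induction over the past: by the recursion, \<open>x i\<close> is built from the
  preceding state, \<open>x c\<close> and a residual with another index, all orthogonal to the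
  residual at \<open>k\<close>. At times 0 and \<open>c\<close>, where no recursion is available,
  the hypotheses step in.\<close>

lemma innovativeI:
  assumes c: "c \<le> N"
    and x0: "\<And>k. k \<in> {1..N} - {c} \<Longrightarrow> orth (residual c G k) (x 0)"
    and xc: "\<And>k. k \<in> {1..N} - {c} \<Longrightarrow> orth (residual c G k) (x c)"
    and res: "\<And>k l. k \<in> {1..N} - {c} \<Longrightarrow> l \<in> {1..N} - {c} \<Longrightarrow> l \<noteq> k \<Longrightarrow>
      orth (residual c G k) (residual c G l)"
  shows "innovative c G"
proof -
  have "orth (x i) (residual c G k)" if k: "k \<in> {1..N} - {c}" and "i < k" for k i
    using \<open>i < k\<close>
  proof (induction i)
    case 0
    show ?case using x0[OF k] orth_commute by blast
  next
    case (Suc n)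
    show ?case
    proof (cases "Suc n = c")
      case True
      then show ?thesis using xc[OF k] orth_commute by blast
    next
      case False
      have xs: "x (Suc n) = (\<lambda>\<omega>. (G (Suc n) n *v x n \<omega> + G (Suc n) c *v x c \<omega>) + residual c G (Suc n) \<omega>)"
        by (simp add: residual_def fun_eq_iff)
      have Sn: "Suc n \<in> {1..N} - {c}" "Suc n \<noteq> k" using False Suc.prems k by auto
      show ?thesis
        unfolding xs
      proof (intro orth_add orth_mult vspan_add vspan_mult vspan_residual vspan_x)
        show "orth (x n) (residual c G k)" using Suc by simp
        show "orth (x c) (residual c G k)" using xc[OF k] orth_commute by blast
        show "orth (residual c G (Suc n)) (residual c G k)" using res[OF Sn(1) k] Sn(2) by blast
      qed (use c k Suc.prems in auto)
    qed
  qed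
  then show ?thesis unfolding innovative_def using xc orth_commute by blast
qed

lemma residual_AE:
  assumes "CM_dynamics M N c x G e" "k \<in> {1..N} - {c}"
  shows "AE \<omega> in M. residual c G k \<omega> = e k \<omega>"
proof -
  have "AE \<omega> in M. x k \<omega> = G k (k - 1) *v x (k - 1) \<omega> + G k c *v x c \<omega> + e k \<omega>"
    using assms by (auto simp: CM_dynamics_def)
  then show ?thesis by eventually_elim (simp add: residual_def)
qed

text \<open>Here \<open>x c\<close> is itself a noise, and \<open>x 0\<close> is a multiple of
  \<open>x c\<close> plus a noise; the residuals at other times are orthogonal to both by
  whiteness.\<close>

lemma innovative_of_dynamics_c:
  assumes c: "c \<in> {0, N}" and e: "white_gaussian_seq M N e"
    and dyn: "CM_dynamics M N c x G e" and bd: "boundary_from_c M N c x G e"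
  shows "innovative c G"
proof -
  have cN: "c \<le> N" using c by auto
  have r: "vspan (residual c G k)" "AE \<omega> in M. residual c G k \<omega> = e k \<omega>" if "k \<in> {1..N} - {c}" for k
    using that residual_AE[OF dyn that] vspan_residual[OF cN] by auto
  have xc: "orth (residual c G k) (x c)" if k: "k \<in> {1..N} - {c}" for k
    by (rule orth_of_white[OF e _ cN _ r[OF k] vspan_x[OF cN]])
      (use k bd in \<open>auto simp: boundary_from_c_def\<close>)
  have x0: "orth (residual c G k) (x 0)" if k: "k \<in> {1..N} - {c}" for k
  proof (cases "c = 0")
    case True
    then show ?thesis using xc[OF k] by simp
  next
    case False
    \<comment> \<open>A version of \<open>e 0\<close> that lies in the span.\<close>
    define y where "y = (\<lambda>\<omega>. x 0 \<omega> - G 0 c *v x c \<omega>)"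
    have y: "vspan y" unfolding y_def using cN by (intro vspan_diff vspan_mult vspan_x) auto
    have "AE \<omega> in M. x 0 \<omega> = G 0 c *v x c \<omega> + e 0 \<omega>"
      using bd False c by (auto simp: boundary_from_c_def)
    then have "AE \<omega> in M. y \<omega> = e 0 \<omega>" by eventually_elim (simp add: y_def)
    then have "orth (residual c G k) y"
      using k by (intro orth_of_white[OF e _ _ _ r[OF k] y, where j = 0]) auto
    then have "orth y (residual c G k)" "orth (x c) (residual c G k)"
      using xc[OF k] orth_commute by blast+
    then have "orth (\<lambda>\<omega>. G 0 c *v x c \<omega> + y \<omega>) (residual c G k)"
      using y r(1)[OF k] cN by (intro orth_add orth_mult vspan_mult vspan_x) auto
    then have "orth (x 0) (residual c G k)" by (simp add: y_def)
    then show ?thesis using orth_commute by blast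
  qed
  show ?thesis
  proof (rule innovativeI[OF cN x0 xc])
    fix k l assume k: "k \<in> {1..N} - {c}" and l: "l \<in> {1..N} - {c}" and "l \<noteq> k"
    then show "orth (residual c G k) (residual c G l)"
      by (intro orth_of_white[OF e _ _ _ r[OF k] r[OF l]]) auto
  qed
qed

text \<open>Mirror image of the previous argument: \<open>x 0\<close> is the noise and
  \<open>x c\<close> is recovered from it.\<close>

lemma innovative_of_dynamics_0:
  assumes c: "c \<in> {0, N}" and e: "white_gaussian_seq M N e"
    and dyn: "CM_dynamics M N c x G e" and bd: "boundary_from_0 M N c x G e"
  shows "innovative c G"
proof -
  have cN: "c \<le> N" using c by auto
  have r: "vspan (residual c G k)" "AE \<omega> in M. residual c G k \<omega> = e k \<omega>" if "k \<in> {1..N} - {c}" for k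
    using that residual_AE[OF dyn that] vspan_residual[OF cN] by auto
  have x0: "orth (residual c G k) (x 0)" if k: "k \<in> {1..N} - {c}" for k
    by (rule orth_of_white[OF e _ le0 _ r[OF k] vspan_x[OF le0]])
      (use k bd in \<open>auto simp: boundary_from_0_def\<close>)
  have xc: "orth (residual c G k) (x c)" if k: "k \<in> {1..N} - {c}" for k
  proof (cases "c = 0")
    case True
    then show ?thesis using x0[OF k] by simp
  next
    case False
    define y where "y = (\<lambda>\<omega>. x c \<omega> - G c 0 *v x 0 \<omega>)"
    have y: "vspan y" unfolding y_def using cN by (intro vspan_diff vspan_mult vspan_x) auto
    have "AE \<omega> in M. x c \<omega> = G c 0 *v x 0 \<omega> + e c \<omega>"
      using bd False c by (auto simp: boundary_from_0_def)
    then have "AE \<omega> in M. y \<omega> = e c \<omega>" by eventually_elim (simp add: y_def)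
    then have "orth (residual c G k) y"
      using k cN by (intro orth_of_white[OF e _ _ _ r[OF k] y, where j = c]) auto
    then have "orth y (residual c G k)" "orth (x 0) (residual c G k)"
      using x0[OF k] orth_commute by blast+
    then have "orth (\<lambda>\<omega>. G c 0 *v x 0 \<omega> + y \<omega>) (residual c G k)"
      using y r(1)[OF k] cN by (intro orth_add orth_mult vspan_mult vspan_x) auto
    then have "orth (x c) (residual c G k)" by (simp add: y_def)
    then show ?thesis using orth_commute by blast
  qed
  show ?thesis
  proof (rule innovativeI[OF cN x0 xc])
    fix k l assume k: "k \<in> {1..N} - {c}" and l: "l \<in> {1..N} - {c}" and "l \<noteq> k"
    then show "orth (residual c G k) (residual c G l)"
      by (intro orth_of_white[OF e _ _ _ r[OF k] r[OF l]]) auto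
  qed
qed

text \<open>One construction serves both boundary conditions, \<open>Q = 0\<close> for the one
  started at \<open>c\<close> and \<open>P = 0\<close> for the one started at 0. Rows 0 and
  \<open>c\<close> of the matrices do not enter the recursion, so they can store \<open>P\<close>
  and \<open>Q\<close>.\<close>

lemma dynamics_of_innovative:
  assumes c: "c \<in> {0, N}" and G: "innovative c G"
    and PQ: "c = 0 \<Longrightarrow> P = 0 \<and> Q = 0"
    and o: "c \<noteq> 0 \<Longrightarrow> orth (\<lambda>\<omega>. x 0 \<omega> - P *v x c \<omega>) (\<lambda>\<omega>. x c \<omega> - Q *v x 0 \<omega>)"
  defines "G' \<equiv> \<lambda>k l. if k = c then Q else if k = 0 then P else G k l"
    and "e \<equiv> \<lambda>k. if k = c then \<lambda>\<omega>. x c \<omega> - Q *v x 0 \<omega> else if k = 0 then \<lambda>\<omega>. x 0 \<omega> - P *v x c \<omega>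
      else residual c G k"
  shows "white_gaussian_seq M N e" "zero_mean_seq M N e" "CM_dynamics M N c x G' e"
proof -
  have cN: "c \<le> N" using c by auto
  have v: "vspan (e k)" if "k \<le> N" for k
    unfolding e_def using that cN
    by (auto intro!: vspan_diff vspan_mult vspan_x vspan_residual)
  \<comment> \<open>Every \<open>e l\<close> considered here is a combination of \<open>x c\<close>
    and states before \<open>k\<close>, to all of which the residual at \<open>k\<close> is
    orthogonal.\<close>
  have less: "orth (e k) (e l)" if k: "k \<in> {1..N} - {c}" and l: "l \<le> N" "l < k \<or> l = c" for k l
  proof -
    have r: "orth (x i) (e k)" if "i \<in> insert c {..<k}" for i
    proof -
      have "orth (residual c G k) (x i)" using G k that unfolding innovative_def by blast
      then show ?thesis using k orth_commute by (auto simp: e_def)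
    qed
    have vk: "vspan (e k)" using k by (intro v) auto
    have "orth (e l) (e k)"
    proof (cases "l = c \<or> l = 0")
      case True
      have "orth (\<lambda>\<omega>. x c \<omega> - Q *v x 0 \<omega>) (e k)" "orth (\<lambda>\<omega>. x 0 \<omega> - P *v x c \<omega>) (e k)"
        using k cN by (auto intro!: orth_diff orth_mult vspan_mult vspan_x r vk)
      then show ?thesis using True by (auto simp: e_def)
    next
      case False
      then have "e l = residual c G l" by (simp add: e_def)
      then show ?thesis
        unfolding residual_def[abs_def] using k l False cN
        by (auto intro!: orth_diff orth_mult vspan_mult vspan_diff vspan_x r vk)
    qed
    then show ?thesis using orth_commute by blast
  qed
  have pair: "orth (e k) (e l)" if kl: "k \<le> N" "l \<le> N" "k \<noteq> l" for k l
  proof -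
    \<comment> \<open>Each pair has a residual whose partner precedes it or sits at
      \<open>c\<close>, except the pair of boundary noises, which \<open>o\<close> settles.\<close>
    consider "k \<noteq> 0" "k \<noteq> c" "l < k \<or> l = c" | "l \<noteq> 0" "l \<noteq> c" "k < l \<or> k = c"
      | "k = 0" "l = c" "c \<noteq> 0" | "k = c" "l = 0" "c \<noteq> 0"
      using kl by (metis less_nat_zero_code nat_neq_iff)
    then show ?thesis
    proof cases
      case 1
      then have "k \<in> {1..N} - {c}" using kl by auto
      then show ?thesis using less 1 kl by blast
    next
      case 2
      then have "l \<in> {1..N} - {c}" using kl by auto
      then show ?thesis using less 2 kl orth_commute by blast
    next
      case 3
      then show ?thesis using o by (simp add: e_def)
    next
      case 4
      then have "orth (e l) (e k)" using o by (simp add: e_def)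
      then show ?thesis using orth_commute by blast
    qed
  qed
  show "white_gaussian_seq M N e" "zero_mean_seq M N e"
    using white_of_orth[of e] v pair by auto
  show "CM_dynamics M N c x G' e"
    by (auto simp: CM_dynamics_def G'_def e_def residual_def)
qed

section \<open>Equivalence with both dynamic models\<close>

lemma CM_seq_iff_innovative: "c \<le> N \<Longrightarrow> CM_seq M N c x \<longleftrightarrow> (\<exists>G. innovative c G)"
  using CM_seq_of_innovative innovative_of_CM_seq by blast

lemma CM_seq_iff_dynamics_c:
  assumes c: "c \<in> {0, N}"
  shows "CM_seq M N c x \<longleftrightarrow>
    (\<exists>G e. white_gaussian_seq M N e \<and> zero_mean_seq M N e \<and> CM_dynamics M N c x G e \<and>
      boundary_from_c M N c x G e)"
proof
  have cN: "c \<le> N" using c by auto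
  assume "CM_seq M N c x"
  then obtain G where G: "innovative c G" using CM_seq_iff_innovative[OF cN] by blast
  obtain A where A: "\<forall>i\<in>{c}. orth (\<lambda>\<omega>. x 0 \<omega> - (\<Sum>i\<in>{c}. A i *v x i \<omega>)) (x i)"
    using projection[of "x 0" "{c}"] cN vspan_x by auto
  \<comment> \<open>Regression matrix of \<open>x 0\<close> on \<open>x c\<close>; for
    \<open>c = 0\<close> the two states coincide and the zero matrix is taken.\<close>
  define P where "P = (if c = 0 then 0 else A c)"
  have o: "orth (\<lambda>\<omega>. x 0 \<omega> - P *v x c \<omega>) (\<lambda>\<omega>. x c \<omega> - 0 *v x 0 \<omega>)" if "c \<noteq> 0"
    using A that by (simp add: P_def)
  have zero: "P = 0 \<and> 0 = 0" if "c = 0"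
    using that by (simp add: P_def)
  have "boundary_from_c M N c x (\<lambda>k l. if k = c then 0 else if k = 0 then P else G k l)
      (\<lambda>k. if k = c then \<lambda>\<omega>. x c \<omega> - 0 *v x 0 \<omega> else if k = 0 then \<lambda>\<omega>. x 0 \<omega> - P *v x c \<omega>
        else residual c G k)"
    using zero by (auto simp: boundary_from_c_def)
  then show "\<exists>G e. white_gaussian_seq M N e \<and> zero_mean_seq M N e \<and> CM_dynamics M N c x G e \<and>
      boundary_from_c M N c x G e"
    using dynamics_of_innovative[OF c G zero o] by blast
next
  assume "\<exists>G e. white_gaussian_seq M N e \<and> zero_mean_seq M N e \<and> CM_dynamics M N c x G e \<and>
      boundary_from_c M N c x G e"
  then show "CM_seq M N c x"
    using CM_seq_of_innovative innovative_of_dynamics_c[OF c] c by blast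
qed

lemma CM_seq_iff_dynamics_0:
  assumes c: "c \<in> {0, N}"
  shows "CM_seq M N c x \<longleftrightarrow>
    (\<exists>G e. white_gaussian_seq M N e \<and> zero_mean_seq M N e \<and> CM_dynamics M N c x G e \<and>
      boundary_from_0 M N c x G e)"
proof
  have cN: "c \<le> N" using c by auto
  assume "CM_seq M N c x"
  then obtain G where G: "innovative c G" using CM_seq_iff_innovative[OF cN] by blast
  obtain A where A: "\<forall>i\<in>{0}. orth (\<lambda>\<omega>. x c \<omega> - (\<Sum>i\<in>{0}. A i *v x i \<omega>)) (x i)"
    using projection[of "x c" "{0}"] cN vspan_x by auto
  \<comment> \<open>Regression matrix of \<open>x c\<close> on \<open>x 0\<close>. For
    \<open>c = 0\<close> the noise is \<open>x 0 - Q *v x 0\<close> and has to equal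
    \<open>x 0\<close>, hence the zero matrix; it also satisfies the second boundary equation when
    \<open>N = 0\<close>.\<close>
  define Q where "Q = (if c = 0 then 0 else A 0)"
  have o: "orth (\<lambda>\<omega>. x 0 \<omega> - 0 *v x c \<omega>) (\<lambda>\<omega>. x c \<omega> - Q *v x 0 \<omega>)" if "c \<noteq> 0"
    using A that orth_commute by (simp add: Q_def)
  have zero: "0 = 0 \<and> Q = 0" if "c = 0"
    using that by (simp add: Q_def)
  have "boundary_from_0 M N c x (\<lambda>k l. if k = c then Q else if k = 0 then 0 else G k l)
      (\<lambda>k. if k = c then \<lambda>\<omega>. x c \<omega> - Q *v x 0 \<omega> else if k = 0 then \<lambda>\<omega>. x 0 \<omega> - 0 *v x c \<omega>
        else residual c G k)"
    using zero by (auto simp: boundary_from_0_def)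
  then show "\<exists>G e. white_gaussian_seq M N e \<and> zero_mean_seq M N e \<and> CM_dynamics M N c x G e \<and>
      boundary_from_0 M N c x G e"
    using dynamics_of_innovative[OF c G zero o] by blast
next
  assume "\<exists>G e. white_gaussian_seq M N e \<and> zero_mean_seq M N e \<and> CM_dynamics M N c x G e \<and>
      boundary_from_0 M N c x G e"
  then show "CM_seq M N c x"
    using CM_seq_of_innovative innovative_of_dynamics_0[OF c] c by blast
qed

end

theorem theorem3p1:
  fixes M :: "'a measure" and N c :: nat and x :: "nat \<Rightarrow> 'a \<Rightarrow> real ^ 'd"
  assumes "prob_space M"
    and "c \<in> {0, N}"
    and "gaussian_seq M N x"
    and "zero_mean_seq M N x"
  shows "(CM_seq M N c x \<longleftrightarrow>
           (\<exists>(G :: nat \<Rightarrow> nat \<Rightarrow> real ^ 'd ^ 'd) (Gcov :: nat \<Rightarrow> real ^ 'd ^ 'd) e.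
              white_gaussian_seq M N e \<and> zero_mean_seq M N e \<and>
              (\<forall>k\<le>N. Gcov k = Cov M (e k)) \<and>
              CM_dynamics M N c x G e \<and> boundary_from_c M N c x G e)) \<and>
         (CM_seq M N c x \<longleftrightarrow>
           (\<exists>(G :: nat \<Rightarrow> nat \<Rightarrow> real ^ 'd ^ 'd) (Gcov :: nat \<Rightarrow> real ^ 'd ^ 'd) e.
              white_gaussian_seq M N e \<and> zero_mean_seq M N e \<and>
              (\<forall>k\<le>N. Gcov k = Cov M (e k)) \<and>
              CM_dynamics M N c x G e \<and> boundary_from_0 M N c x G e))"
proof -
  interpret centered_gaussian_seq M N x
    using assms by (simp add: centered_gaussian_seq_def centered_gaussian_seq_axioms_def)
  \<comment> \<open>\<open>Gcov\<close> merely names the covariances of \<open>e\<close>, so its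
    quantifier can be eliminated.\<close>
  have Gcov: "(\<exists>G Gcov e. W e \<and> Z e \<and> (\<forall>k\<le>N. Gcov k = Cov M (e k)) \<and> D G e \<and> B G e) \<longleftrightarrow>
      (\<exists>G e. W e \<and> Z e \<and> D G e \<and> B G e)"
    for W Z :: "(nat \<Rightarrow> 'a \<Rightarrow> real ^ 'd) \<Rightarrow> bool"
      and D B :: "(nat \<Rightarrow> nat \<Rightarrow> real ^ 'd ^ 'd) \<Rightarrow> (nat \<Rightarrow> 'a \<Rightarrow> real ^ 'd) \<Rightarrow> bool"
  proof
    assume "\<exists>G e. W e \<and> Z e \<and> D G e \<and> B G e"
    then obtain G e where "W e \<and> Z e \<and> D G e \<and> B G e" by blast
    then show "\<exists>G Gcov e. W e \<and> Z e \<and> (\<forall>k\<le>N. Gcov k = Cov M (e k)) \<and> D G e \<and> B G e"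
      by (intro exI[of _ G] exI[of _ "\<lambda>k. Cov M (e k)"] exI[of _ e]) simp
  qed blast
  show ?thesis
    unfolding Gcov using CM_seq_iff_dynamics_c[OF assms(2)] CM_seq_iff_dynamics_0[OF assms(2)] by blast
qed

end
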